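(* Let $\mathrm{M}$ be an o-minimal structure expanding $(\mathbb{R},<,+,\cdot)$. The category $\mathrm{Sys}_{\mathrm{oi}}$ of heterogeneous Mealy machines over $\mathrm{Def}(\mathrm{M})$ (all with non-empty input and output sets) and definable open immersions has pullbacks, computed componentwise as intersections of definable opens, and the coverings (finite families $\{m_\alpha:\mathcal{S}_\alpha\hookrightarrow\mathcal{S}\}$ of definable open immersions that are jointly surjective on $S_b\times I$ and on $S_a\times O$) define a Grothendieck pretopology on $\mathrm{Sys}_{\mathrm{oi}}$, making $(\mathrm{Sys}_{\mathrm{oi}},\mathrm{Cov})$ a site.
   Context: An o-minimal structure $\mathrm{M}$ expanding $(\mathbb{R},<,+,\cdot)$ is given by a sequence $(\mathcal{D}_n)_{n\ge 1}$ of Boolean algebras of subsets of $\mathbb{R}^n$, closed under products and projections, such that $\mathcal{D}_n$ contains all semialgebraic sets and $\mathcal{D}_1$ consists exactly of finite unions of intervals and points. Elements of $\mathcal{D}_n$ are the definable sets; a function between them is definable if its graph is. $\mathrm{Def}(\mathrm{M})$ is the category of definable sets and definable maps (not necessarily continuous). Each definable set $X\subseteq\mathbb{R}^n$ inherits a topology from $\mathbb{R}^n$. A definable open immersion $\iota:U\hookrightarrow X$ is a definable injection whose image is a definable open subset; open immersions are understood to be continuous, as inclusions of open subsets with the subspace topology. A heterogeneous Mealy machine (system) is a quintuple $\mathcal{S}=(S_b,S_a,I,O,\alpha)$ of definable sets $S_b$ (before-states), $S_a$ (after-states), $I$ (inputs), $O$ (outputs) and a definable map $\alpha:S_b\times I\to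 S_a\times O$. All systems are assumed to have non-empty $I$ and $O$. A morphism $\mathcal{S}\to\mathcal{S}'$ is a 4-tuple $(f_b,f_a,f_I,f_O)$ of definable maps $S_b\to S_b'$, $S_a\to S_a'$, $I\to I'$, $O\to O'$ with $(f_a\times f_O)\circ\alpha=\alpha'\circ(f_b\times f_I)$. These form the category $\mathrm{Sys}$. A morphism of systems is a definable open immersion if each of its four components is a definable open immersion. $\mathrm{Sys}_{\mathrm{oi}}$ is the wide subcategory of $\mathrm{Sys}$ (same objects) with the definable open immersions as morphisms. A finite family $\{m_\alpha:\mathcal{S}_\alpha\hookrightarrow\mathcal{S}\}$ of definable open immersions, with $\mathcal{S}_\alpha=(S_{\alpha,b},S_{\alpha,a},I_\alpha,O_\alpha,\cdot)$, is a covering if the induced maps $\bigsqcup_\alpha(S_{\alpha,b}\times I_\alpha)\to S_b\times I$ and $\bigsqcup_\alpha(S_{\alpha,a}\times O_\alpha)\to S_a\times O$ are both surjective. $\mathrm{Cov}$ denotes the collection of coverings. A Grothendieck pretopology is a collection of covering families that contains the isomorphisms and is stable under pullback and under composition (transitivity).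
   Formalization: Pullbacks in Sys_oi are shown exactly when the intersection has non-empty inputs and outputs, and coverings are stable where base changes exist; the full pullback and site claim is shown with empty I, O allowed; open immersions are homeomorphisms onto their image. *)

theory Defs
  imports "HOL-Analysis.Analysis"
begin

section \<open>Definable sets and maps\<close>

text \<open>A point of \<open>\<real>\<^sup>n\<close> is a function \<open>nat \<Rightarrow> real\<close> vanishing from index \<open>n\<close> on, that is, an element of
  the topological space \<^const>\<open>Euclidean_space\<close> \<open>n\<close>.\<close>

type_synonym pt = "nat \<Rightarrow> real"

abbreviation Rn :: "nat \<Rightarrow> pt set"
  where "Rn n \<equiv> topspace (Euclidean_space n)"

text \<open>The identification of \<open>\<real>\<^sup>n \<times> \<real>\<^sup>m\<close> with \<open>\<real>\<^sup>n\<^sup>+\<^sup>m\<close>.\<close>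

definition append_pt :: "nat \<Rightarrow> pt \<Rightarrow> pt \<Rightarrow> pt"
  where "append_pt n x y = (\<lambda>i. if i < n then x i else y (i - n))"

definition take_pt :: "nat \<Rightarrow> pt \<Rightarrow> pt"
  where "take_pt n x = (\<lambda>i. if i < n then x i else 0)"

definition drop_pt :: "nat \<Rightarrow> pt \<Rightarrow> pt"
  where "drop_pt n x = (\<lambda>i. x (i + n))"

text \<open>Real polynomial functions in the variables \<open>x 0, \<dots>, x (n - 1)\<close>.\<close>

inductive_set poly_functions :: "nat \<Rightarrow> (pt \<Rightarrow> real) set" for n :: nat where
  const: "(\<lambda>x. c) \<in> poly_functions n"
| coord: "i < n \<Longrightarrow> (\<lambda>x. x i) \<in> poly_functions n"
| add: "p \<in> poly_functions n \<Longrightarrow> q \<in> poly_functions n \<Longrightarrow> (\<lambda>x. p x + q x) \<in> poly_functions n"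
| mult: "p \<in> poly_functions n \<Longrightarrow> q \<in> poly_functions n \<Longrightarrow> (\<lambda>x. p x * q x) \<in> poly_functions n"

inductive_set semialgebraic :: "nat \<Rightarrow> pt set set" for n :: nat where
  eq: "p \<in> poly_functions n \<Longrightarrow> {x \<in> Rn n. p x = 0} \<in> semialgebraic n"
| pos: "p \<in> poly_functions n \<Longrightarrow> {x \<in> Rn n. p x > 0} \<in> semialgebraic n"
| compl: "A \<in> semialgebraic n \<Longrightarrow> Rn n - A \<in> semialgebraic n"
| union: "A \<in> semialgebraic n \<Longrightarrow> B \<in> semialgebraic n \<Longrightarrow> A \<union> B \<in> semialgebraic n"

text \<open>O-minimal structures expanding the real field. Only the values \<open>D n\<close> for \<open>n \<ge> 1\<close> matter.
  Points need no separate clause in the description of \<open>D 1\<close>: singletons satisfy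
  \<^const>\<open>is_interval\<close>, as do bounded and unbounded intervals of every kind.\<close>

locale o_minimal =
  fixes D :: "nat \<Rightarrow> pt set set"
  assumes subset_Rn: "1 \<le> n \<Longrightarrow> A \<in> D n \<Longrightarrow> A \<subseteq> Rn n"
    and empty: "1 \<le> n \<Longrightarrow> {} \<in> D n"
    and complement: "1 \<le> n \<Longrightarrow> A \<in> D n \<Longrightarrow> Rn n - A \<in> D n"
    and union: "1 \<le> n \<Longrightarrow> A \<in> D n \<Longrightarrow> B \<in> D n \<Longrightarrow> A \<union> B \<in> D n"
    and product: "1 \<le> n \<Longrightarrow> 1 \<le> m \<Longrightarrow> A \<in> D n \<Longrightarrow> B \<in> D m \<Longrightarrow>
                    {append_pt n x y | x y. x \<in> A \<and> y \<in> B} \<in> D (n + m)"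
    and proj_left: "1 \<le> n \<Longrightarrow> 1 \<le> m \<Longrightarrow> A \<in> D (n + m) \<Longrightarrow> take_pt n ` A \<in> D n"
    and proj_right: "1 \<le> n \<Longrightarrow> 1 \<le> m \<Longrightarrow> A \<in> D (n + m) \<Longrightarrow> drop_pt n ` A \<in> D m"
    and semialgebraic: "1 \<le> n \<Longrightarrow> semialgebraic n \<subseteq> D n"
    and one_dim: "D 1 = {{x \<in> Rn 1. x 0 \<in> \<Union>F} | F :: real set set. finite F \<and> (\<forall>J\<in>F. is_interval J)}"

text \<open>A definable set carries the dimension of its ambient space.\<close>

type_synonym dset = "nat \<times> pt set"

abbreviation dim_of :: "dset \<Rightarrow> nat" where "dim_of \<equiv> fst"
abbreviation pts :: "dset \<Rightarrow> pt set" where "pts \<equiv> snd"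

definition definable_set :: "(nat \<Rightarrow> pt set set) \<Rightarrow> dset \<Rightarrow> bool"
  where "definable_set D X \<longleftrightarrow> 1 \<le> dim_of X \<and> pts X \<in> D (dim_of X)"

definition dtop :: "dset \<Rightarrow> pt topology"
  where "dtop X = subtopology (Euclidean_space (dim_of X)) (pts X)"

text \<open>Maps are extensional functions (\<^const>\<open>undefined\<close> off the domain), so that equality of functions
  is equality of maps.\<close>

definition definable_map :: "(nat \<Rightarrow> pt set set) \<Rightarrow> dset \<Rightarrow> dset \<Rightarrow> (pt \<Rightarrow> pt) \<Rightarrow> bool"
  where "definable_map D X Y f \<longleftrightarrow>
    f \<in> pts X \<rightarrow>\<^sub>E pts Y \<and>
    {append_pt (dim_of X) x (f x) | x. x \<in> pts X} \<in> D (dim_of X + dim_of Y)"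

text \<open>Open immersions are, up to identification, inclusions of definable open subsets with the
  subspace topology; hence they are required to be homeomorphisms onto their image
  (\<^const>\<open>embedding_map\<close>), not merely continuous injections.\<close>

definition definable_open_immersion :: "(nat \<Rightarrow> pt set set) \<Rightarrow> dset \<Rightarrow> dset \<Rightarrow> (pt \<Rightarrow> pt) \<Rightarrow> bool"
  where "definable_open_immersion D X Y f \<longleftrightarrow>
    definable_map D X Y f \<and> inj_on f (pts X) \<and>
    f ` pts X \<in> D (dim_of Y) \<and> openin (dtop Y) (f ` pts X) \<and>
    embedding_map (dtop X) (dtop Y) f"

section \<open>Categories, pullbacks, pretopologies\<close>

record ('o, 'a) cat =
  Obj :: "'o set"
  Arr :: "'a set"
  Dom :: "'a \<Rightarrow> 'o"
  Cod :: "'a \<Rightarrow> 'o"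
  Id :: "'o \<Rightarrow> 'a"
  Comp :: "'a \<Rightarrow> 'a \<Rightarrow> 'a"  \<comment> \<open>\<open>Comp C g f\<close> is \<open>g\<close> after \<open>f\<close>\<close>

definition hom :: "('o, 'a) cat \<Rightarrow> 'o \<Rightarrow> 'o \<Rightarrow> 'a set"
  where "hom C X Y = {f \<in> Arr C. Dom C f = X \<and> Cod C f = Y}"

locale category =
  fixes C :: "('o, 'a) cat"
  assumes dom_obj: "f \<in> Arr C \<Longrightarrow> Dom C f \<in> Obj C"
    and cod_obj: "f \<in> Arr C \<Longrightarrow> Cod C f \<in> Obj C"
    and id_hom: "X \<in> Obj C \<Longrightarrow> Id C X \<in> hom C X X"
    and comp_hom: "f \<in> hom C X Y \<Longrightarrow> g \<in> hom C Y Z \<Longrightarrow> Comp C g f \<in> hom C X Z"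
    and id_left: "f \<in> hom C X Y \<Longrightarrow> Comp C (Id C Y) f = f"
    and id_right: "f \<in> hom C X Y \<Longrightarrow> Comp C f (Id C X) = f"
    and assoc: "f \<in> hom C W X \<Longrightarrow> g \<in> hom C X Y \<Longrightarrow> h \<in> hom C Y Z \<Longrightarrow>
                  Comp C h (Comp C g f) = Comp C (Comp C h g) f"

definition is_iso :: "('o, 'a) cat \<Rightarrow> 'a \<Rightarrow> bool"
  where "is_iso C f \<longleftrightarrow> f \<in> Arr C \<and>
    (\<exists>g \<in> hom C (Cod C f) (Dom C f).
       Comp C g f = Id C (Dom C f) \<and> Comp C f g = Id C (Cod C f))"

definition commuting_square :: "('o, 'a) cat \<Rightarrow> 'a \<Rightarrow> 'a \<Rightarrow> 'a \<Rightarrow> 'a \<Rightarrow> bool"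
  where "commuting_square C f g p q \<longleftrightarrow>
    f \<in> Arr C \<and> g \<in> Arr C \<and> p \<in> Arr C \<and> q \<in> Arr C \<and>
    Cod C f = Cod C g \<and> Dom C p = Dom C q \<and> Cod C p = Dom C f \<and> Cod C q = Dom C g \<and>
    Comp C f p = Comp C g q"

definition is_pullback :: "('o, 'a) cat \<Rightarrow> 'a \<Rightarrow> 'a \<Rightarrow> 'a \<Rightarrow> 'a \<Rightarrow> bool"
  where "is_pullback C f g p q \<longleftrightarrow> commuting_square C f g p q \<and>
    (\<forall>h k. commuting_square C f g h k \<longrightarrow>
       (\<exists>!u. u \<in> hom C (Dom C h) (Dom C p) \<and> Comp C p u = h \<and> Comp C q u = k))"

definition has_pullbacks :: "('o, 'a) cat \<Rightarrow> bool"
  where "has_pullbacks C \<longleftrightarrow>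
    (\<forall>f\<in>Arr C. \<forall>g\<in>Arr C. Cod C f = Cod C g \<longrightarrow> (\<exists>p q. is_pullback C f g p q))"

text \<open>\<open>Cov X\<close> is the collection of families covering \<open>X\<close>; a family is represented by its set of
  arrows. In \<open>cov_stable\<close>, pullbacks of the members of \<open>R\<close> along \<open>g\<close> are chosen arbitrarily; their
  existence is the separate condition \<open>cov_base_change\<close>.\<close>

definition cov_families :: "('o, 'a) cat \<Rightarrow> ('o \<Rightarrow> 'a set set) \<Rightarrow> bool"
  where "cov_families C Cov \<longleftrightarrow>
    (\<forall>X\<in>Obj C. \<forall>R\<in>Cov X. R \<subseteq> {f \<in> Arr C. Cod C f = X})"

definition cov_iso :: "('o, 'a) cat \<Rightarrow> ('o \<Rightarrow> 'a set set) \<Rightarrow> bool"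
  where "cov_iso C Cov \<longleftrightarrow> (\<forall>f. is_iso C f \<longrightarrow> {f} \<in> Cov (Cod C f))"

definition cov_base_change :: "('o, 'a) cat \<Rightarrow> ('o \<Rightarrow> 'a set set) \<Rightarrow> bool"
  where "cov_base_change C Cov \<longleftrightarrow>
    (\<forall>g\<in>Arr C. \<forall>R\<in>Cov (Cod C g). \<forall>f\<in>R. \<exists>p q. is_pullback C f g p q)"

definition cov_stable :: "('o, 'a) cat \<Rightarrow> ('o \<Rightarrow> 'a set set) \<Rightarrow> bool"
  where "cov_stable C Cov \<longleftrightarrow>
    (\<forall>g\<in>Arr C. \<forall>R\<in>Cov (Cod C g). \<forall>p q.
       (\<forall>f\<in>R. is_pullback C f g (p f) (q f)) \<longrightarrow> q ` R \<in> Cov (Dom C g))"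

definition cov_transitive :: "('o, 'a) cat \<Rightarrow> ('o \<Rightarrow> 'a set set) \<Rightarrow> bool"
  where "cov_transitive C Cov \<longleftrightarrow>
    (\<forall>X\<in>Obj C. \<forall>R\<in>Cov X. \<forall>T. (\<forall>f\<in>R. T f \<in> Cov (Dom C f)) \<longrightarrow>
       {Comp C f h | f h. f \<in> R \<and> h \<in> T f} \<in> Cov X)"

definition grothendieck_pretopology :: "('o, 'a) cat \<Rightarrow> ('o \<Rightarrow> 'a set set) \<Rightarrow> bool"
  where "grothendieck_pretopology C Cov \<longleftrightarrow>
    cov_families C Cov \<and> cov_iso C Cov \<and> cov_base_change C Cov \<and>
    cov_stable C Cov \<and> cov_transitive C Cov"

definition site :: "('o, 'a) cat \<Rightarrow> ('o \<Rightarrow> 'a set set) \<Rightarrow> bool"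
  where "site C Cov \<longleftrightarrow> category C \<and> grothendieck_pretopology C Cov"

section \<open>Heterogeneous Mealy machines\<close>

record system =
  before :: dset
  after :: dset
  inp :: dset
  outp :: dset
  act :: "pt \<times> pt \<Rightarrow> pt \<times> pt"

text \<open>The last condition says that the graph of the action is definable, with the coordinates of
  \<open>(b, i, a, o)\<close> concatenated in this order.\<close>

definition is_system :: "(nat \<Rightarrow> pt set set) \<Rightarrow> system \<Rightarrow> bool"
  where "is_system D S \<longleftrightarrow>
    definable_set D (before S) \<and> definable_set D (after S) \<and>
    definable_set D (inp S) \<and> definable_set D (outp S) \<and>
    act S \<in> pts (before S) \<times> pts (inp S) \<rightarrow>\<^sub>E pts (after S) \<times> pts (outp S) \<and>
    {append_pt (dim_of (before S)) b (append_pt (dim_of (inp S)) i (append_pt (dim_of (after S)) a y))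
      | b i a y. b \<in> pts (before S) \<and> i \<in> pts (inp S) \<and> act S (b, i) = (a, y)}
      \<in> D (dim_of (before S) + (dim_of (inp S) + (dim_of (after S) + dim_of (outp S))))"

definition nonempty_io :: "system \<Rightarrow> bool"
  where "nonempty_io S \<longleftrightarrow> pts (inp S) \<noteq> {} \<and> pts (outp S) \<noteq> {}"

record sys_arrow =
  src :: system
  tgt :: system
  m_before :: "pt \<Rightarrow> pt"
  m_after :: "pt \<Rightarrow> pt"
  m_inp :: "pt \<Rightarrow> pt"
  m_outp :: "pt \<Rightarrow> pt"

definition is_sys_morphism :: "(nat \<Rightarrow> pt set set) \<Rightarrow> sys_arrow \<Rightarrow> bool"
  where "is_sys_morphism D f \<longleftrightarrow>
    definable_map D (before (src f)) (before (tgt f)) (m_before f) \<and>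
    definable_map D (after (src f)) (after (tgt f)) (m_after f) \<and>
    definable_map D (inp (src f)) (inp (tgt f)) (m_inp f) \<and>
    definable_map D (outp (src f)) (outp (tgt f)) (m_outp f) \<and>
    (\<forall>z \<in> pts (before (src f)) \<times> pts (inp (src f)).
       map_prod (m_after f) (m_outp f) (act (src f) z) =
       act (tgt f) (map_prod (m_before f) (m_inp f) z))"

definition is_sys_open_immersion :: "(nat \<Rightarrow> pt set set) \<Rightarrow> sys_arrow \<Rightarrow> bool"
  where "is_sys_open_immersion D f \<longleftrightarrow> is_sys_morphism D f \<and>
    definable_open_immersion D (before (src f)) (before (tgt f)) (m_before f) \<and>
    definable_open_immersion D (after (src f)) (after (tgt f)) (m_after f) \<and>
    definable_open_immersion D (inp (src f)) (inp (tgt f)) (m_inp f) \<and>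
    definable_open_immersion D (outp (src f)) (outp (tgt f)) (m_outp f)"

definition sys_id :: "system \<Rightarrow> sys_arrow"
  where "sys_id S = \<lparr>src = S, tgt = S,
    m_before = restrict id (pts (before S)), m_after = restrict id (pts (after S)),
    m_inp = restrict id (pts (inp S)), m_outp = restrict id (pts (outp S))\<rparr>"

definition sys_comp :: "sys_arrow \<Rightarrow> sys_arrow \<Rightarrow> sys_arrow"
  where "sys_comp g f = \<lparr>src = src f, tgt = tgt g,
    m_before = compose (pts (before (src f))) (m_before g) (m_before f),
    m_after = compose (pts (after (src f))) (m_after g) (m_after f),
    m_inp = compose (pts (inp (src f))) (m_inp g) (m_inp f),
    m_outp = compose (pts (outp (src f))) (m_outp g) (m_outp f)\<rparr>"

text \<open>The category of the systems satisfying \<open>P\<close> and all morphisms between them, and its wide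
  subcategory of open immersions.\<close>

definition sys_cat :: "(nat \<Rightarrow> pt set set) \<Rightarrow> (system \<Rightarrow> bool) \<Rightarrow> (system, sys_arrow) cat"
  where "sys_cat D P = \<lparr>Obj = {S. is_system D S \<and> P S},
    Arr = {f. is_system D (src f) \<and> P (src f) \<and> is_system D (tgt f) \<and> P (tgt f) \<and> is_sys_morphism D f},
    Dom = src, Cod = tgt, Id = sys_id, Comp = sys_comp\<rparr>"

definition open_immersions :: "(nat \<Rightarrow> pt set set) \<Rightarrow> (system, sys_arrow) cat \<Rightarrow> (system, sys_arrow) cat"
  where "open_immersions D C = C\<lparr>Arr := {f \<in> Arr C. is_sys_open_immersion D f}\<rparr>"

definition Sys :: "(nat \<Rightarrow> pt set set) \<Rightarrow> (system, sys_arrow) cat"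
  where "Sys D = sys_cat D nonempty_io"

definition Sys_oi :: "(nat \<Rightarrow> pt set set) \<Rightarrow> (system, sys_arrow) cat"
  where "Sys_oi D = open_immersions D (Sys D)"

text \<open>Two open immersions into the same system may have disjoint images in the input set or in the
  output set. The componentwise intersection then has no inputs or no outputs; it is not an object
  of \<open>Sys_oi D\<close>, and no commuting square over the two immersions exists there. \<open>Sys_oi_ext D\<close>
  contains \<open>Sys_oi D\<close> as a full subcategory and admits these degenerate systems as objects.\<close>

definition Sys_oi_ext :: "(nat \<Rightarrow> pt set set) \<Rightarrow> (system, sys_arrow) cat"
  where "Sys_oi_ext D = open_immersions D (sys_cat D (\<lambda>S. True))"

text \<open>The system on the intersections of the images of two open immersions into the same system, with
  the restricted action, and its comparison maps, which invert the immersions on these intersections.\<close>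

definition inter_system :: "sys_arrow \<Rightarrow> sys_arrow \<Rightarrow> system"
  where "inter_system f g = (let
      cap = (\<lambda>c m. (dim_of (c (tgt f)), m f ` pts (c (src f)) \<inter> m g ` pts (c (src g))));
      B = cap before m_before; I = cap inp m_inp
    in \<lparr>before = B, after = cap after m_after, inp = I, outp = cap outp m_outp,
        act = restrict (act (tgt f)) (pts B \<times> pts I)\<rparr>)"

definition inter_proj :: "system \<Rightarrow> sys_arrow \<Rightarrow> sys_arrow"
  where "inter_proj P f = \<lparr>src = P, tgt = src f,
    m_before = restrict (inv_into (pts (before (src f))) (m_before f)) (pts (before P)),
    m_after = restrict (inv_into (pts (after (src f))) (m_after f)) (pts (after P)),
    m_inp = restrict (inv_into (pts (inp (src f))) (m_inp f)) (pts (inp P)),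
    m_outp = restrict (inv_into (pts (outp (src f))) (m_outp f)) (pts (outp P))\<rparr>"

definition is_inter_pullback :: "(system, sys_arrow) cat \<Rightarrow> sys_arrow \<Rightarrow> sys_arrow \<Rightarrow> bool"
  where "is_inter_pullback C f g \<longleftrightarrow>
    is_pullback C f g (inter_proj (inter_system f g) f) (inter_proj (inter_system f g) g)"

definition Cov :: "(system, sys_arrow) cat \<Rightarrow> system \<Rightarrow> sys_arrow set set"
  where "Cov C S = {R. finite R \<and> R \<subseteq> {f \<in> Arr C. Cod C f = S} \<and>
    (\<Union>f\<in>R. map_prod (m_before f) (m_inp f) ` (pts (before (src f)) \<times> pts (inp (src f))))
      = pts (before S) \<times> pts (inp S) \<and>
    (\<Union>f\<in>R. map_prod (m_after f) (m_outp f) ` (pts (after (src f)) \<times> pts (outp (src f))))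
      = pts (after S) \<times> pts (outp S)}"

end

theory Submission
  imports Defs
begin

text \<open>The proof rests on a single property of open immersions: if \<open>f : Y \<rightarrow> Z\<close> and
  \<open>h : X \<rightarrow> Z\<close> are definable open immersions and the image of \<open>h\<close> lies in that of \<open>f\<close>, then the map
  \<open>u\<close> with \<open>f \<circ> u = h\<close> is a definable open immersion again (\<open>open_immersion_lift\<close>). Topologically this
  is the fact that \<open>f\<close> is an open embedding. Definability comes from viewing maps as definable
  relations: the graph of \<open>u\<close> is the graph of \<open>h\<close> followed by the converse of the graph of \<open>f\<close>, and
  definable relations are closed under converse and composition. That closure, in turn, needs
  coordinates to be permuted, duplicated and forgotten at arbitrary positions, whereas the axioms
  project only onto initial or final blocks of coordinates; the polynomial equations \<open>x\<^sub>i = x\<^sub>j\<close>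
  bridge the gap (\<open>reindex_image\<close>, \<open>reindex_vimage\<close>).

  For systems, lifting is done in each of the four components, and the lift respects the actions
  because the components of \<open>f\<close> are injective (\<open>system_immersion_lift\<close>); injectivity also makes every
  open immersion a monomorphism. Now let \<open>f\<close> and \<open>g\<close> have the same target. The intersection of their
  images is a system: an input and state in both images are sent by the action to an output and state
  in both images. Its inclusion into the target lifts along \<open>f\<close> and along \<open>g\<close>, which gives the two
  projections. If \<open>f \<circ> h = g \<circ> k\<close>, then this composite has its image in the intersection, so it lifts
  to the intersection, uniquely; this is the universal property (\<open>inter_pullback\<close>). It holds in the
  full subcategory of any class of systems that contains the intersection. In \<open>Sys_oi\<close> the
  intersection is an object as soon as some commuting square over \<open>f\<close> and \<open>g\<close> exists, since the
  inputs and outputs of its corner are then mapped into the intersection.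

  For the pretopology, the point is that a pullback of \<open>f\<close> along \<open>g\<close> has as its image in the source
  of \<open>g\<close> the whole preimage under \<open>g\<close> of the image of \<open>f\<close> (\<open>pullback_image\<close>), so joint surjectivity
  is inherited. All constructions are uniform in the class of systems, so \<open>Sys_oi\<close> and \<open>Sys_oi_ext\<close>
  are treated at once.\<close>section \<open>Coordinates\<close>

lemma mem_Rn: "x \<in> Rn n \<longleftrightarrow> (\<forall>i\<ge>n. x i = 0)"
  by (simp add: topspace_Euclidean_space)

lemma append_pt_in_Rn: "y \<in> Rn m \<Longrightarrow> append_pt n x y \<in> Rn (n + m)"
  by (simp add: mem_Rn append_pt_def)

lemma take_append_pt: "x \<in> Rn n \<Longrightarrow> take_pt n (append_pt n x y) = x"
  by (auto simp: mem_Rn append_pt_def take_pt_def fun_eq_iff)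

lemma drop_append_pt: "drop_pt n (append_pt n x y) = y"
  by (auto simp: append_pt_def drop_pt_def fun_eq_iff)

lemma append_pt_inject:
  "x \<in> Rn n \<Longrightarrow> x' \<in> Rn n \<Longrightarrow> append_pt n x y = append_pt n x' y' \<longleftrightarrow> x = x' \<and> y = y'"
  by (metis take_append_pt drop_append_pt)

text \<open>For \<open>\<sigma>\<close> mapping indices below \<open>m\<close> to indices below \<open>n\<close>, this is the polynomial map
  \<open>\<real>\<^sup>n \<rightarrow> \<real>\<^sup>m\<close> that selects the coordinates \<open>\<sigma> 0, \<dots>, \<sigma> (m - 1)\<close>. Every permutation, duplication or
  omission of coordinates has this form.\<close>

definition reindex :: "nat \<Rightarrow> (nat \<Rightarrow> nat) \<Rightarrow> pt \<Rightarrow> pt"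
  where "reindex m \<sigma> x = (\<lambda>i. if i < m then x (\<sigma> i) else 0)"

lemma reindex_in_Rn: "reindex m \<sigma> x \<in> Rn m"
  by (simp add: mem_Rn reindex_def)

section \<open>Definable sets and relations\<close>

context o_minimal
begin

lemma inter: "1 \<le> n \<Longrightarrow> A \<in> D n \<Longrightarrow> B \<in> D n \<Longrightarrow> A \<inter> B \<in> D n"
proof -
  assume n: "1 \<le> n" and A: "A \<in> D n" and B: "B \<in> D n"
  have "A \<inter> B = Rn n - ((Rn n - A) \<union> (Rn n - B))"
    using subset_Rn[OF n A] subset_Rn[OF n B] by blast
  then show ?thesis using n A B by (simp add: complement union)
qed

lemma whole: "1 \<le> n \<Longrightarrow> Rn n \<in> D n"
  using complement[OF _ empty] by simp

lemma coordinates_equal: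
  fixes k :: nat
  assumes "1 \<le> n" "\<And>i. i < k \<Longrightarrow> a i < n \<and> b i < n"
  shows "{w \<in> Rn n. \<forall>i<k. w (a i) = w (b i)} \<in> D n"
  using assms(2)
proof (induction k)
  case 0
  show ?case using whole[OF assms(1)] by simp
next
  case (Suc k)
  have "(\<lambda>x. x (a k) + (\<lambda>x. - 1) x * x (b k)) \<in> poly_functions n"
    using Suc.prems[of k] by (intro poly_functions.intros) auto
  then have "{w \<in> Rn n. w (a k) + - 1 * w (b k) = 0} \<in> D n"
    using semialgebraic.eq semialgebraic[OF assms(1)] by blast
  moreover have "{w \<in> Rn n. \<forall>i<k. w (a i) = w (b i)} \<in> D n"
    using Suc.IH Suc.prems by simp
  moreover have "{w \<in> Rn n. \<forall>i<Suc k. w (a i) = w (b i)} =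
      {w \<in> Rn n. \<forall>i<k. w (a i) = w (b i)} \<inter> {w \<in> Rn n. w (a k) + - 1 * w (b k) = 0}"
    by (auto simp: less_Suc_eq)
  ultimately show ?case using inter[OF assms(1)] by simp
qed

text \<open>The graph of the reindexing map, with the values written first, is cut out of \<open>\<real>\<^sup>m \<times> A\<close> by
  equations between coordinates; the image is the projection of this set to its first \<open>m\<close>
  coordinates.\<close>

lemma reindex_image:
  assumes A: "A \<in> D n" and n: "1 \<le> n" and m: "1 \<le> m" and \<sigma>: "\<And>i. i < m \<Longrightarrow> \<sigma> i < n"
  shows "reindex m \<sigma> ` A \<in> D m"
proof -
  let ?P = "{append_pt m x y | x y. x \<in> Rn m \<and> y \<in> A}"
  let ?E = "{w \<in> Rn (m + n). \<forall>i<m. w i = w (m + \<sigma> i)}"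
  have "?P \<inter> ?E \<in> D (m + n)"
    using inter product[OF m n whole[OF m] A] coordinates_equal[of "m + n" m "\<lambda>i. i"] \<sigma> m
    by simp
  then have "take_pt m ` (?P \<inter> ?E) \<in> D m"
    using proj_left m n by blast
  moreover have "take_pt m ` (?P \<inter> ?E) = reindex m \<sigma> ` A"
  proof (intro equalityI subsetI)
    fix w assume "w \<in> take_pt m ` (?P \<inter> ?E)"
    then obtain x y where w: "w = take_pt m (append_pt m x y)" "x \<in> Rn m" "y \<in> A"
      and e: "\<And>i. i < m \<Longrightarrow> append_pt m x y i = append_pt m x y (m + \<sigma> i)" by blast
    have "w = reindex m \<sigma> y"
      using e w(2) unfolding w(1) by (auto simp: fun_eq_iff take_pt_def reindex_def append_pt_def)
    then show "w \<in> reindex m \<sigma> ` A" using w by blast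
  next
    fix w assume "w \<in> reindex m \<sigma> ` A"
    then obtain y where y: "y \<in> A" "w = reindex m \<sigma> y" by blast
    have "append_pt m w y \<in> ?P" using y reindex_in_Rn by blast
    moreover have "append_pt m w y \<in> ?E"
      using y subset_Rn[OF n A] append_pt_in_Rn[of y n m w]
      by (auto simp: reindex_def append_pt_def)
    ultimately have "append_pt m w y \<in> ?P \<inter> ?E" by blast
    then show "w \<in> take_pt m ` (?P \<inter> ?E)"
      using take_append_pt[of w m y] y(2) reindex_in_Rn by (metis (no_types, lifting) image_eqI)
  qed
  ultimately show ?thesis by simp
qed

text \<open>The same argument with the arguments written first: project from \<open>\<real>\<^sup>n \<times> A\<close> to the first factor.\<close>

lemma reindex_vimage:
  assumes A: "A \<in> D m" and n: "1 \<le> n" and m: "1 \<le> m" and \<sigma>: "\<And>i. i < m \<Longrightarrow> \<sigma> i < n"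
  shows "{x \<in> Rn n. reindex m \<sigma> x \<in> A} \<in> D n"
proof -
  let ?P = "{append_pt n x y | x y. x \<in> Rn n \<and> y \<in> A}"
  let ?E = "{w \<in> Rn (n + m). \<forall>i<m. w (\<sigma> i) = w (n + i)}"
  have "\<And>i. i < m \<Longrightarrow> \<sigma> i < n + m \<and> n + i < n + m"
    using \<sigma> by (simp add: trans_less_add1)
  then have "?P \<inter> ?E \<in> D (n + m)"
    using inter product[OF n m whole[OF n] A] coordinates_equal[of "n + m" m \<sigma>] m by simp
  then have "take_pt n ` (?P \<inter> ?E) \<in> D n"
    using proj_left m n by blast
  moreover have "take_pt n ` (?P \<inter> ?E) = {x \<in> Rn n. reindex m \<sigma> x \<in> A}"
  proof (intro equalityI subsetI)
    fix w assume "w \<in> take_pt n ` (?P \<inter> ?E)"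
    then obtain x y where w: "w = take_pt n (append_pt n x y)" "x \<in> Rn n" "y \<in> A"
      and e: "\<And>i. i < m \<Longrightarrow> append_pt n x y (\<sigma> i) = append_pt n x y (n + i)" by blast
    have "w = x" using w take_append_pt by simp
    moreover have "reindex m \<sigma> x = y"
      using e \<sigma> w(3) subset_Rn[OF m A] by (auto simp: fun_eq_iff reindex_def append_pt_def mem_Rn)
    ultimately show "w \<in> {x \<in> Rn n. reindex m \<sigma> x \<in> A}" using w by simp
  next
    fix w assume w: "w \<in> {x \<in> Rn n. reindex m \<sigma> x \<in> A}"
    have "append_pt n w (reindex m \<sigma> w) \<in> ?P" using w by blast
    moreover have "append_pt n w (reindex m \<sigma> w) \<in> ?E"
      using append_pt_in_Rn[OF reindex_in_Rn, of n w m \<sigma>] \<sigma>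
      by (auto simp: reindex_def append_pt_def)
    ultimately have "append_pt n w (reindex m \<sigma> w) \<in> ?P \<inter> ?E" by blast
    then show "w \<in> take_pt n ` (?P \<inter> ?E)"
      using take_append_pt[of w n] w by (metis (no_types, lifting) image_eqI mem_Collect_eq)
  qed
  ultimately show ?thesis by simp
qed

text \<open>Relations are more convenient than functions here, because inverses and factorizations of
  injective maps are obtained from converse and composition without proving functionality first.\<close>

definition definable_rel :: "nat \<Rightarrow> nat \<Rightarrow> (pt \<times> pt) set \<Rightarrow> bool"
  where "definable_rel n m R \<longleftrightarrow> 1 \<le> n \<and> 1 \<le> m \<and> R \<subseteq> Rn n \<times> Rn m \<and>
    (\<lambda>(x, y). append_pt n x y) ` R \<in> D (n + m)"

lemma definable_rel_converse:
  assumes "definable_rel n m R"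
  shows "definable_rel m n (R\<inverse>)"
proof -
  let ?\<sigma> = "\<lambda>i. if i < m then n + i else i - m"
  have nm: "1 \<le> n" "1 \<le> m" "R \<subseteq> Rn n \<times> Rn m" using assms by (auto simp: definable_rel_def)
  have "reindex (m + n) ?\<sigma> ` (\<lambda>(x, y). append_pt n x y) ` R \<in> D (m + n)"
    using assms by (intro reindex_image[of _ "n + m"]) (auto simp: definable_rel_def)
  also have "reindex (m + n) ?\<sigma> ` (\<lambda>(x, y). append_pt n x y) ` R
      = (\<lambda>(y, x). append_pt m y x) ` (R\<inverse>)"
  proof -
    have "reindex (m + n) ?\<sigma> (append_pt n x y) = append_pt m y x" if "(x, y) \<in> R" for x y
    proof -
      have "x \<in> Rn n" "y \<in> Rn m" using that nm by auto
      then show ?thesis by (auto simp: fun_eq_iff reindex_def append_pt_def mem_Rn)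
    qed
    then show ?thesis by (force simp: image_iff)
  qed
  finally show ?thesis using nm by (auto simp: definable_rel_def)
qed

text \<open>With the middle point shared, the triples \<open>(x, y, z)\<close> with \<open>(x, y) \<in> R\<close> and \<open>(y, z) \<in> S\<close> form an
  intersection of two preimages under reindexing, and omitting \<open>y\<close> is another reindexing.\<close>

lemma definable_rel_relcomp:
  assumes R: "definable_rel n m R" and S: "definable_rel m k S"
  shows "definable_rel n k (R O S)"
proof -
  have d: "1 \<le> n" "1 \<le> m" "1 \<le> k" "R \<subseteq> Rn n \<times> Rn m" "S \<subseteq> Rn m \<times> Rn k"
    using assms by (auto simp: definable_rel_def)
  let ?F = "(\<lambda>(x, y). append_pt n x y) ` R" and ?G = "(\<lambda>(x, y). append_pt m x y) ` S"
  let ?N = "n + (m + k)"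
  let ?W = "{w \<in> Rn ?N. reindex (n + m) id w \<in> ?F} \<inter> {w \<in> Rn ?N. reindex (m + k) (\<lambda>i. n + i) w \<in> ?G}"
  \<comment> \<open>selects \<open>x\<close> and \<open>z\<close> from \<open>(x, y, z)\<close>: the coordinates of \<open>z\<close> start at \<open>n + m\<close>, and \<open>i \<ge> n\<close>\<close>
  let ?\<sigma> = "\<lambda>i. if i < n then i else m + i"
  have "?W \<in> D ?N"
    using R S d by (intro inter reindex_vimage) (auto simp: definable_rel_def)
  then have "reindex (n + k) ?\<sigma> ` ?W \<in> D (n + k)"
    using d by (intro reindex_image[of _ ?N]) auto
  also have "reindex (n + k) ?\<sigma> ` ?W = (\<lambda>(x, y). append_pt n x y) ` (R O S)"
  proof (intro equalityI subsetI)
    fix v assume "v \<in> reindex (n + k) ?\<sigma> ` ?W"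
    then obtain w x y y' z where w: "w \<in> Rn ?N" "v = reindex (n + k) ?\<sigma> w"
      and xy: "(x, y) \<in> R" "reindex (n + m) id w = append_pt n x y"
      and yz: "(y', z) \<in> S" "reindex (m + k) (\<lambda>i. n + i) w = append_pt m y' z"
      by force
    have dom: "x \<in> Rn n" "y \<in> Rn m" "y' \<in> Rn m" "z \<in> Rn k" using d xy yz by auto
    have x: "x i = w i" if "i < n" for i
      using fun_cong[OF xy(2), of i] that by (simp add: reindex_def append_pt_def)
    have y: "y i = w (n + i)" if "i < m" for i
      using fun_cong[OF xy(2), of "n + i"] that by (simp add: reindex_def append_pt_def)
    have y': "y' i = w (n + i)" if "i < m" for i
      using fun_cong[OF yz(2), of i] that by (simp add: reindex_def append_pt_def)
    have z: "z i = w (n + (m + i))" if "i < k" for i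
      using fun_cong[OF yz(2), of "m + i"] that by (simp add: reindex_def append_pt_def)
    have "y = y'"
    proof
      fix i show "y i = y' i" using y y' dom by (cases "i < m") (auto simp: mem_Rn)
    qed
    moreover have "v = append_pt n x z"
    proof
      fix i
      consider "i < n" | "n \<le> i" "i < n + k" | "n + k \<le> i" by linarith
      then show "v i = append_pt n x z i"
      proof cases
        case 2
        then have "n + (m + (i - n)) = m + i" by simp
        then show ?thesis using 2 z[of "i - n"] by (simp add: w reindex_def append_pt_def)
      qed (use x dom in \<open>auto simp: w reindex_def append_pt_def mem_Rn\<close>)
    qed
    ultimately show "v \<in> (\<lambda>(x, y). append_pt n x y) ` (R O S)" using xy yz by force
  next
    fix v assume "v \<in> (\<lambda>(x, y). append_pt n x y) ` (R O S)"
    then obtain x y z where v: "v = append_pt n x z" "(x, y) \<in> R" "(y, z) \<in> S" by auto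
    then have dom: "x \<in> Rn n" "y \<in> Rn m" "z \<in> Rn k" using d by auto
    let ?w = "append_pt n x (append_pt m y z)"
    have "?w \<in> Rn ?N" using dom by (intro append_pt_in_Rn)
    moreover have "reindex (n + m) id ?w = append_pt n x y"
      using dom by (auto simp: fun_eq_iff reindex_def append_pt_def mem_Rn)
    moreover have "reindex (m + k) (\<lambda>i. n + i) ?w = append_pt m y z"
      using dom by (auto simp: fun_eq_iff reindex_def append_pt_def mem_Rn)
    moreover have "reindex (n + k) ?\<sigma> ?w = v"
      using dom by (auto simp: v fun_eq_iff reindex_def append_pt_def mem_Rn)
    ultimately show "v \<in> reindex (n + k) ?\<sigma> ` ?W" using v by (force simp: image_iff)
  qed
  finally show ?thesis using d by (auto simp: definable_rel_def)
qed

lemma definable_rel_Id_on: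
  assumes "A \<in> D n" "1 \<le> n"
  shows "definable_rel n n (Id_on A)"
proof -
  let ?\<sigma> = "\<lambda>i. if i < n then i else i - n"
  have A: "A \<subseteq> Rn n" using assms subset_Rn by blast
  have "reindex (n + n) ?\<sigma> ` A \<in> D (n + n)"
    using assms by (intro reindex_image[of _ n]) auto
  moreover have "reindex (n + n) ?\<sigma> x = append_pt n x x" if "x \<in> A" for x
    using that A by (auto simp: fun_eq_iff reindex_def append_pt_def mem_Rn)
  then have "reindex (n + n) ?\<sigma> ` A = (\<lambda>(x, y). append_pt n x y) ` Id_on A"
    by (force simp: Id_on_def image_iff)
  ultimately show ?thesis using assms A by (auto simp: definable_rel_def)
qed

lemma definable_rel_Range:
  assumes "definable_rel n m R"
  shows "Range R \<in> D m"
proof -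
  have "drop_pt n ` (\<lambda>(x, y). append_pt n x y) ` R \<in> D m"
    using assms proj_right unfolding definable_rel_def by blast
  moreover have "drop_pt n ` (\<lambda>(x, y). append_pt n x y) ` R = Range R"
    by (force simp: image_iff drop_append_pt)
  ultimately show ?thesis by simp
qed

end

section \<open>Definable open immersions\<close>

definition map_graph :: "pt set \<Rightarrow> (pt \<Rightarrow> pt) \<Rightarrow> (pt \<times> pt) set"
  where "map_graph A f = (\<lambda>x. (x, f x)) ` A"

context o_minimal
begin

lemma topspace_dtop: "definable_set D X \<Longrightarrow> topspace (dtop X) = pts X"
  using subset_Rn by (auto simp: definable_set_def dtop_def)

lemma definable_map_iff_graph:
  assumes X: "definable_set D X" and Y: "definable_set D Y"
  shows "definable_map D X Y f \<longleftrightarrow>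
    f \<in> pts X \<rightarrow>\<^sub>E pts Y \<and> definable_rel (dim_of X) (dim_of Y) (map_graph (pts X) f)"
proof -
  have "{append_pt (dim_of X) x (f x) | x. x \<in> pts X}
      = (\<lambda>(x, y). append_pt (dim_of X) x y) ` map_graph (pts X) f"
    by (auto simp: map_graph_def)
  moreover have "f \<in> pts X \<rightarrow>\<^sub>E pts Y \<Longrightarrow> map_graph (pts X) f \<subseteq> Rn (dim_of X) \<times> Rn (dim_of Y)"
    using X Y subset_Rn by (fastforce simp: map_graph_def definable_set_def)
  ultimately show ?thesis
    using X Y by (auto simp: definable_map_def definable_rel_def definable_set_def)
qed

text \<open>That the image is definable and open follows from the right-hand side, since the range of a
  definable relation is definable and an open map has an open image. Continuity and openness are easier to transport along composition and
  lifting than an embedding onto a varying subspace.\<close>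

lemma definable_open_immersion_iff:
  assumes X: "definable_set D X" and Y: "definable_set D Y"
  shows "definable_open_immersion D X Y f \<longleftrightarrow>
    definable_map D X Y f \<and> inj_on f (pts X) \<and>
    continuous_map (dtop X) (dtop Y) f \<and> open_map (dtop X) (dtop Y) f"
proof (intro iffI)
  assume f: "definable_open_immersion D X Y f"
  let ?Z = "subtopology (dtop Y) (f ` pts X)"
  have "homeomorphic_map (dtop X) ?Z f" and o: "openin (dtop Y) (f ` pts X)"
    using f topspace_dtop[OF X] by (auto simp: definable_open_immersion_def embedding_map_def)
  then have c: "continuous_map (dtop X) ?Z f" and p: "open_map (dtop X) ?Z f"
    by (auto simp: homeomorphic_eq_everything_map)
  have "continuous_map (dtop X) (dtop Y) f" using c by (rule continuous_map_into_fulltopology)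
  moreover have "open_map (dtop X) (dtop Y) f"
    using p o openin_trans_full unfolding open_map_def by blast
  ultimately show "definable_map D X Y f \<and> inj_on f (pts X) \<and>
      continuous_map (dtop X) (dtop Y) f \<and> open_map (dtop X) (dtop Y) f"
    using f by (simp add: definable_open_immersion_def)
next
  assume f: "definable_map D X Y f \<and> inj_on f (pts X) \<and>
    continuous_map (dtop X) (dtop Y) f \<and> open_map (dtop X) (dtop Y) f"
  have "Range (map_graph (pts X) f) = f ` pts X" by (auto simp: map_graph_def)
  then have "f ` pts X \<in> D (dim_of Y)"
    using f definable_rel_Range definable_map_iff_graph[OF X Y] by metis
  moreover have "openin (dtop Y) (f ` pts X)"
    using f topspace_dtop[OF X] openin_topspace by (metis open_map_def)
  ultimately show "definable_open_immersion D X Y f"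
    using f topspace_dtop[OF X]
    by (simp add: definable_open_immersion_def injective_open_imp_embedding_map)
qed

lemma open_immersion_inclusion:
  assumes Y: "definable_set D Y" and B: "B \<in> D (dim_of Y)" "openin (dtop Y) B"
  shows "definable_open_immersion D (dim_of Y, B) Y (restrict id B)"
proof -
  have sub: "B \<subseteq> pts Y" using openin_subset[OF B(2)] topspace_dtop[OF Y] by simp
  have X: "definable_set D (dim_of Y, B)" using Y B by (simp add: definable_set_def)
  have top: "dtop (dim_of Y, B) = subtopology (dtop Y) B"
    using sub by (simp add: dtop_def subtopology_subtopology Int_absorb1)
  have id: "id x = restrict id B x" if "x \<in> topspace (dtop (dim_of Y, B))" for x
    using that by (simp add: topspace_dtop[OF X])
  have "map_graph B (restrict id B) = Id_on B" by (auto simp: map_graph_def)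
  then have "definable_map D (dim_of Y, B) Y (restrict id B)"
    using definable_rel_Id_on[OF B(1)] Y sub
    by (auto simp: definable_map_iff_graph[OF X Y] definable_set_def)
  moreover have "continuous_map (dtop (dim_of Y, B)) (dtop Y) (restrict id B)"
    by (rule continuous_map_eq[OF _ id]) (auto simp: top continuous_map_from_subtopology)
  moreover have "open_map (dtop (dim_of Y, B)) (dtop Y) (restrict id B)"
    by (rule open_map_eq[OF _ id], unfold top, rule open_map_inclusion[OF B(2)])
  ultimately show ?thesis
    by (simp add: definable_open_immersion_iff[OF X Y])
qed

lemma open_immersion_id:
  assumes X: "definable_set D X"
  shows "definable_open_immersion D X X (restrict id (pts X))"
  using open_immersion_inclusion[OF X, of "pts X"] X topspace_dtop[OF X] openin_topspace[of "dtop X"]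
  by (simp add: definable_set_def)

lemma open_immersion_compose:
  assumes X: "definable_set D X" and Y: "definable_set D Y" and Z: "definable_set D Z"
    and f: "definable_open_immersion D X Y f" and g: "definable_open_immersion D Y Z g"
  shows "definable_open_immersion D X Z (compose (pts X) g f)"
proof -
  note iff = definable_open_immersion_iff[OF X Y] definable_open_immersion_iff[OF Y Z]
    definable_map_iff_graph[OF X Y] definable_map_iff_graph[OF Y Z]
  have fg: "f \<in> pts X \<rightarrow>\<^sub>E pts Y" "g \<in> pts Y \<rightarrow>\<^sub>E pts Z" using f g by (auto simp: iff)
  have eq: "(g \<circ> f) x = compose (pts X) g f x" if "x \<in> topspace (dtop X)" for x
    using that by (simp add: topspace_dtop[OF X] compose_def)
  have "map_graph (pts X) (compose (pts X) g f) = map_graph (pts X) f O map_graph (pts Y) g"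
    using fg by (fastforce simp: map_graph_def compose_def)
  then have "definable_map D X Z (compose (pts X) g f)"
    using f g fg definable_rel_relcomp
    by (auto simp: iff definable_map_iff_graph[OF X Z] compose_def)
  moreover have "inj_on (compose (pts X) g f) (pts X)"
    using f g fg by (auto simp: iff compose_def inj_on_eq_iff[of g] PiE_mem intro!: inj_onI dest: inj_onD)
  moreover have "continuous_map (dtop X) (dtop Z) (compose (pts X) g f)"
    using f g by (intro continuous_map_eq[OF _ eq] continuous_map_compose) (auto simp: iff)
  moreover have "open_map (dtop X) (dtop Z) (compose (pts X) g f)"
    using f g by (intro open_map_eq[OF _ eq] open_map_compose) (auto simp: iff)
  ultimately show ?thesis by (simp add: definable_open_immersion_iff[OF X Z])
qed

text \<open>The graph of \<open>u\<close> is that of \<open>h\<close> composed with the converse of that of \<open>f\<close>. For the topology,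
  injectivity of \<open>f\<close> gives \<open>u\<^sup>-\<^sup>1(V) = h\<^sup>-\<^sup>1(f(V))\<close> and \<open>u(V) = f\<^sup>-\<^sup>1(h(V))\<close>, which are open for open \<open>V\<close>.\<close>

lemma open_immersion_lift:
  assumes X: "definable_set D X" and Y: "definable_set D Y" and Z: "definable_set D Z"
    and f: "definable_open_immersion D Y Z f" and h: "definable_open_immersion D X Z h"
    and u: "u \<in> pts X \<rightarrow>\<^sub>E pts Y" and fu: "\<And>x. x \<in> pts X \<Longrightarrow> f (u x) = h x"
  shows "definable_open_immersion D X Y u"
proof -
  note iff = definable_open_immersion_iff[OF X Z] definable_open_immersion_iff[OF Y Z]
    definable_map_iff_graph[OF X Z] definable_map_iff_graph[OF Y Z]
  note top = topspace_dtop[OF X] topspace_dtop[OF Y] topspace_dtop[OF Z]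
  have inj: "inj_on f (pts Y)" using f by (simp add: iff)
  have uY: "u x \<in> pts Y" if "x \<in> pts X" for x using u that by auto
  have "map_graph (pts X) u = map_graph (pts X) h O (map_graph (pts Y) f)\<inverse>"
    using fu uY inj by (fastforce simp: map_graph_def inj_on_def)
  then have "definable_map D X Y u"
    using f h u definable_rel_relcomp definable_rel_converse
    by (auto simp: iff definable_map_iff_graph[OF X Y])
  moreover have "inj_on u (pts X)"
    using h fu by (auto simp: iff inj_on_def) metis
  moreover have "continuous_map (dtop X) (dtop Y) u"
    unfolding continuous_map_def
  proof (intro conjI allI impI)
    show "u \<in> topspace (dtop X) \<rightarrow> topspace (dtop Y)" using uY by (simp add: top)
    fix V assume V: "openin (dtop Y) V"
    then have VY: "V \<subseteq> pts Y" using openin_subset[OF V] by (simp add: top)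
    then have "{x \<in> topspace (dtop X). u x \<in> V} = {x \<in> topspace (dtop X). h x \<in> f ` V}"
      using fu uY inj_on_image_mem_iff[OF inj] by (metis (no_types, lifting) top(1))
    moreover have "openin (dtop Z) (f ` V)" using f V by (simp add: iff open_map_def)
    ultimately show "openin (dtop X) {x \<in> topspace (dtop X). u x \<in> V}"
      using h by (simp add: iff continuous_map_def)
  qed
  moreover have "open_map (dtop X) (dtop Y) u"
    unfolding open_map_def
  proof (intro allI impI)
    fix V assume V: "openin (dtop X) V"
    then have VX: "V \<subseteq> pts X" using openin_subset[OF V] by (simp add: top)
    have "u ` V = {y \<in> topspace (dtop Y). f y \<in> h ` V}"
    proof (intro equalityI subsetI)
      fix y assume "y \<in> u ` V"
      then show "y \<in> {y \<in> topspace (dtop Y). f y \<in> h ` V}"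
        using VX fu uY by (auto simp: top)
    next
      fix y assume "y \<in> {y \<in> topspace (dtop Y). f y \<in> h ` V}"
      then obtain x where x: "x \<in> V" "f y = h x" "y \<in> pts Y" by (auto simp: top)
      have "x \<in> pts X" using x VX by blast
      then have "f y = f (u x)" "u x \<in> pts Y" using fu uY x by simp_all
      then have "y = u x" using inj_onD[OF inj] x by blast
      then show "y \<in> u ` V" using x by blast
    qed
    moreover have "openin (dtop Z) (h ` V)" using h V by (simp add: iff open_map_def)
    ultimately show "openin (dtop Y) (u ` V)"
      using f by (simp add: iff continuous_map_def)
  qed
  ultimately show ?thesis by (simp add: definable_open_immersion_iff[OF X Y])
qed

end

section \<open>Open immersions of systems, component by component\<close>

text \<open>The four kinds of sets in a system, each paired with the matching component of an arrow. A
  statement about all \<open>(c, m) \<in> components\<close> covers the four components at once.\<close>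

definition components :: "((system \<Rightarrow> dset) \<times> (sys_arrow \<Rightarrow> pt \<Rightarrow> pt)) set"
  where "components = {(before, m_before), (after, m_after), (inp, m_inp), (outp, m_outp)}"

definition respects_act :: "sys_arrow \<Rightarrow> bool"
  where "respects_act f \<longleftrightarrow> (\<forall>z \<in> pts (before (src f)) \<times> pts (inp (src f)).
    map_prod (m_after f) (m_outp f) (act (src f) z) =
    act (tgt f) (map_prod (m_before f) (m_inp f) z))"

definition system_immersion :: "(nat \<Rightarrow> pt set set) \<Rightarrow> sys_arrow \<Rightarrow> bool"
  where "system_immersion D f \<longleftrightarrow> is_system D (src f) \<and> is_system D (tgt f) \<and>
    (\<forall>(c, m) \<in> components. definable_open_immersion D (c (src f)) (c (tgt f)) (m f)) \<and>
    respects_act f"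

text \<open>The class \<open>P\<close> of admitted systems is kept arbitrary: \<open>nonempty_io\<close> gives \<open>Sys_oi\<close>, and the class
  of all systems gives \<open>Sys_oi_ext\<close>.\<close>

abbreviation oi_cat :: "(nat \<Rightarrow> pt set set) \<Rightarrow> (system \<Rightarrow> bool) \<Rightarrow> (system, sys_arrow) cat"
  where "oi_cat D P \<equiv> open_immersions D (sys_cat D P)"

lemma oi_cat_simps [simp]:
  "Obj (oi_cat D P) = {S. is_system D S \<and> P S}"
  "Arr (oi_cat D P) = {f. system_immersion D f \<and> P (src f) \<and> P (tgt f)}"
  "Dom (oi_cat D P) = src" "Cod (oi_cat D P) = tgt"
  "Id (oi_cat D P) = sys_id" "Comp (oi_cat D P) = sys_comp"
  by (auto simp: open_immersions_def sys_cat_def system_immersion_def respects_act_def components_def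
      is_sys_open_immersion_def is_sys_morphism_def definable_open_immersion_def)

lemma system_immersionI:
  assumes "is_system D (src f)" "is_system D (tgt f)"
    and "\<And>c m. (c, m) \<in> components \<Longrightarrow> definable_open_immersion D (c (src f)) (c (tgt f)) (m f)"
    and "respects_act f"
  shows "system_immersion D f"
  using assms by (auto simp: system_immersion_def)

lemma arrow_eqI:
  fixes f g :: sys_arrow
  assumes "src f = src g" "tgt f = tgt g" "\<And>c m. (c, m) \<in> components \<Longrightarrow> m f = m g"
  shows "f = g"
  using assms(1,2) assms(3)[of before m_before] assms(3)[of after m_after]
    assms(3)[of inp m_inp] assms(3)[of outp m_outp]
  by (simp add: components_def)

lemma src_tgt_sys_comp [simp]: "src (sys_comp g f) = src f" "tgt (sys_comp g f) = tgt g"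
  by (simp_all add: sys_comp_def)

lemma src_tgt_sys_id [simp]: "src (sys_id S) = S" "tgt (sys_id S) = S"
  by (simp_all add: sys_id_def)

lemma component_sys_comp:
  "(c, m) \<in> components \<Longrightarrow> m (sys_comp g f) = compose (pts (c (src f))) (m g) (m f)"
  by (auto simp: components_def sys_comp_def)

lemma component_sys_id:
  "(c, m) \<in> components \<Longrightarrow> m (sys_id S) = restrict id (pts (c S))"
  by (auto simp: components_def sys_id_def)

lemma component_definable:
  "is_system D S \<Longrightarrow> (c, m) \<in> components \<Longrightarrow> definable_set D (c S)"
  by (auto simp: components_def is_system_def)

lemma system_immersion_component:
  assumes "system_immersion D f" "(c, m) \<in> components"
  shows "definable_open_immersion D (c (src f)) (c (tgt f)) (m f)"
    and "inj_on (m f) (pts (c (src f)))"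
    and "m f \<in> pts (c (src f)) \<rightarrow>\<^sub>E pts (c (tgt f))"
    and "x \<in> pts (c (src f)) \<Longrightarrow> m f x \<in> pts (c (tgt f))"
proof -
  show 1: "definable_open_immersion D (c (src f)) (c (tgt f)) (m f)"
    using assms by (auto simp: system_immersion_def)
  then show "inj_on (m f) (pts (c (src f)))" "m f \<in> pts (c (src f)) \<rightarrow>\<^sub>E pts (c (tgt f))"
    by (auto simp: definable_open_immersion_def definable_map_def)
  then show "x \<in> pts (c (src f)) \<Longrightarrow> m f x \<in> pts (c (tgt f))" by auto
qed

lemma act_in:
  assumes "is_system D S" "b \<in> pts (before S)" "i \<in> pts (inp S)"
  shows "fst (act S (b, i)) \<in> pts (after S)" "snd (act S (b, i)) \<in> pts (outp S)"
proof -
  have "act S \<in> pts (before S) \<times> pts (inp S) \<rightarrow>\<^sub>E pts (after S) \<times> pts (outp S)"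
    using assms(1) by (simp add: is_system_def)
  then have "act S (b, i) \<in> pts (after S) \<times> pts (outp S)"
    using assms(2,3) by (blast dest: PiE_mem)
  then show "fst (act S (b, i)) \<in> pts (after S)" "snd (act S (b, i)) \<in> pts (outp S)" by auto
qed

lemma respects_actD:
  assumes "respects_act f" "b \<in> pts (before (src f))" "i \<in> pts (inp (src f))"
  shows "act (tgt f) (m_before f b, m_inp f i) =
    (m_after f (fst (act (src f) (b, i))), m_outp f (snd (act (src f) (b, i))))"
  using assms by (cases "act (src f) (b, i)") (force simp: respects_act_def)

lemma respects_actI:
  assumes "\<And>b i. b \<in> pts (before (src f)) \<Longrightarrow> i \<in> pts (inp (src f)) \<Longrightarrow>
    act (tgt f) (m_before f b, m_inp f i) =
    (m_after f (fst (act (src f) (b, i))), m_outp f (snd (act (src f) (b, i))))"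
  shows "respects_act f"
  using assms by (auto simp: respects_act_def map_prod_def split_beta)

lemma component_cases:
  "(before, m_before) \<in> components" "(after, m_after) \<in> components"
  "(inp, m_inp) \<in> components" "(outp, m_outp) \<in> components"
  by (simp_all add: components_def)

context o_minimal
begin

lemma system_immersion_id:
  assumes "is_system D S"
  shows "system_immersion D (sys_id S)"
proof (rule system_immersionI)
  fix c m assume cm: "(c, m) \<in> components"
  show "definable_open_immersion D (c (src (sys_id S))) (c (tgt (sys_id S))) (m (sys_id S))"
    unfolding component_sys_id[OF cm] src_tgt_sys_id
    by (rule open_immersion_id[OF component_definable[OF assms cm]])
next
  show "respects_act (sys_id S)"
    using act_in[OF assms] by (auto intro!: respects_actI simp: sys_id_def)
qed (use assms in simp_all)

lemma system_immersion_comp: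
  assumes f: "system_immersion D f" and g: "system_immersion D g" and t: "tgt f = src g"
  shows "system_immersion D (sys_comp g f)"
proof (rule system_immersionI)
  have S: "is_system D (src f)" "is_system D (tgt f)" "is_system D (tgt g)"
    using f g by (auto simp: system_immersion_def)
  then show "is_system D (src (sys_comp g f))" "is_system D (tgt (sys_comp g f))" by simp_all
  show "definable_open_immersion D (c (src (sys_comp g f))) (c (tgt (sys_comp g f))) (m (sys_comp g f))"
    if cm: "(c, m) \<in> components" for c m
    unfolding component_sys_comp[OF cm] src_tgt_sys_comp
    by (rule open_immersion_compose[OF _ _ _ system_immersion_component(1)[OF f cm]])
      (use component_definable[OF _ cm] S system_immersion_component(1)[OF g cm] t in auto)
  show "respects_act (sys_comp g f)"
  proof (rule respects_actI)
    fix b i assume bi: "b \<in> pts (before (src (sys_comp g f)))" "i \<in> pts (inp (src (sys_comp g f)))"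
    then have bi': "b \<in> pts (before (src f))" "i \<in> pts (inp (src f))" by simp_all
    note a = act_in[OF S(1) bi']
    have "m_before f b \<in> pts (before (src g))" "m_inp f i \<in> pts (inp (src g))"
      using system_immersion_component(4)[OF f] bi' component_cases t by metis+
    then have "act (tgt g) (m_before g (m_before f b), m_inp g (m_inp f i)) =
      (m_after g (m_after f (fst (act (src f) (b, i)))), m_outp g (m_outp f (snd (act (src f) (b, i)))))"
      using respects_actD[of f b i] respects_actD[of g] f g bi' t by (simp add: system_immersion_def)
    then show "act (tgt (sys_comp g f)) (m_before (sys_comp g f) b, m_inp (sys_comp g f) i) =
      (m_after (sys_comp g f) (fst (act (src (sys_comp g f)) (b, i))),
       m_outp (sys_comp g f) (snd (act (src (sys_comp g f)) (b, i))))"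
      using a bi' by (simp add: sys_comp_def compose_def)
  qed
qed

text \<open>The components lift by the corresponding fact for definable sets. The action equation for \<open>u\<close>
  becomes the one for \<open>h\<close> after applying \<open>f\<close> to both sides, and \<open>f\<close> is injective on after-states and
  on outputs.\<close>

lemma system_immersion_lift:
  assumes f: "system_immersion D f" and h: "system_immersion D h" and t: "tgt f = tgt h"
    and su: "src u = src h" and tu: "tgt u = src f"
    and u: "\<And>c m. (c, m) \<in> components \<Longrightarrow> m u \<in> pts (c (src h)) \<rightarrow>\<^sub>E pts (c (src f))"
    and fu: "\<And>c m x. (c, m) \<in> components \<Longrightarrow> x \<in> pts (c (src h)) \<Longrightarrow> m f (m u x) = m h x"
  shows "system_immersion D u" "sys_comp f u = h"
proof -
  have S: "is_system D (src h)" "is_system D (src f)" "is_system D (tgt h)"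
    using f h by (auto simp: system_immersion_def)
  have immersion: "definable_open_immersion D (c (src u)) (c (tgt u)) (m u)"
    if cm: "(c, m) \<in> components" for c m
    using open_immersion_lift[OF component_definable[OF S(1) cm] component_definable[OF S(2) cm]
        component_definable[OF S(3) cm] _ system_immersion_component(1)[OF h cm] u[OF cm] fu[OF cm]]
      system_immersion_component(1)[OF f cm] by (simp add: su tu t)
  have "respects_act u"
  proof (rule respects_actI)
    fix b i assume "b \<in> pts (before (src u))" "i \<in> pts (inp (src u))"
    then have bi: "b \<in> pts (before (src h))" "i \<in> pts (inp (src h))" by (simp_all add: su)
    have ubi: "m_before u b \<in> pts (before (src f))" "m_inp u i \<in> pts (inp (src f))"
      using u[OF component_cases(1)] u[OF component_cases(3)] bi by auto
    define z where "z = act (src f) (m_before u b, m_inp u i)"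
    define w where "w = act (src h) (b, i)"
    have z: "fst z \<in> pts (after (src f))" "snd z \<in> pts (outp (src f))"
      using act_in[OF S(2) ubi] by (simp_all add: z_def)
    have w: "fst w \<in> pts (after (src h))" "snd w \<in> pts (outp (src h))"
      using act_in[OF S(1) bi] by (simp_all add: w_def)
    have uw: "m_after u (fst w) \<in> pts (after (src f))" "m_outp u (snd w) \<in> pts (outp (src f))"
      using u[OF component_cases(2)] u[OF component_cases(4)] w by auto
    have "(m_after f (fst z), m_outp f (snd z)) = act (tgt f) (m_before f (m_before u b), m_inp f (m_inp u i))"
      using respects_actD[OF _ ubi] f by (simp add: z_def system_immersion_def)
    also have "\<dots> = act (tgt h) (m_before h b, m_inp h i)"
      using fu[OF component_cases(1) bi(1)] fu[OF component_cases(3) bi(2)] t by simp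
    also have "\<dots> = (m_after h (fst w), m_outp h (snd w))"
      using respects_actD[OF _ bi] h by (simp add: w_def system_immersion_def)
    also have "\<dots> = (m_after f (m_after u (fst w)), m_outp f (m_outp u (snd w)))"
      using fu[OF component_cases(2) w(1)] fu[OF component_cases(4) w(2)] by simp
    finally have "fst z = m_after u (fst w)" "snd z = m_outp u (snd w)"
      using inj_onD[OF system_immersion_component(2)[OF f component_cases(2)] _ z(1) uw(1)]
        inj_onD[OF system_immersion_component(2)[OF f component_cases(4)] _ z(2) uw(2)] by simp_all
    then show "act (tgt u) (m_before u b, m_inp u i) =
        (m_after u (fst (act (src u) (b, i))), m_outp u (snd (act (src u) (b, i))))"
      by (simp add: z_def w_def su tu prod_eq_iff)
  qed
  then show "system_immersion D u"
    using S immersion by (auto simp: system_immersion_def su tu)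
  show "sys_comp f u = h"
  proof (rule arrow_eqI)
    fix c m assume cm: "(c, m) \<in> components"
    show "m (sys_comp f u) = m h"
      using fu[OF cm] system_immersion_component(3)[OF h cm]
      by (auto simp: component_sys_comp[OF cm] su compose_def fun_eq_iff PiE_def extensional_def)
  qed (simp_all add: su t)
qed

lemma system_immersion_mono:
  assumes f: "system_immersion D f" and u: "system_immersion D u" and v: "system_immersion D v"
    and t: "tgt u = src f" "tgt v = src f" and s: "src u = src v"
    and eq: "sys_comp f u = sys_comp f v"
  shows "u = v"
proof (rule arrow_eqI)
  fix c m assume cm: "(c, m) \<in> components"
  show "m u = m v"
  proof (rule PiE_ext[where k = "pts (c (src u))" and s = "\<lambda>_. pts (c (src f))"])
    show "m u \<in> pts (c (src u)) \<rightarrow>\<^sub>E pts (c (src f))" "m v \<in> pts (c (src u)) \<rightarrow>\<^sub>E pts (c (src f))"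
      using system_immersion_component(3)[OF u cm] system_immersion_component(3)[OF v cm] t s by simp_all
    then have U: "m u x \<in> pts (c (src f))" "m v x \<in> pts (c (src f))" if "x \<in> pts (c (src u))" for x
      using that by (auto dest: PiE_mem)
    fix x assume x: "x \<in> pts (c (src u))"
    have "m (sys_comp f u) x = m (sys_comp f v) x" using eq by simp
    then have "m f (m u x) = m f (m v x)"
      using x s by (simp add: component_sys_comp[OF cm] compose_def)
    then show "m u x = m v x"
      using inj_onD[OF system_immersion_component(2)[OF f cm]] U[OF x] by blast
  qed
qed (simp_all add: s t)

lemma category_oi: "category (oi_cat D P)"
proof
  show "f \<in> Arr (oi_cat D P) \<Longrightarrow> Dom (oi_cat D P) f \<in> Obj (oi_cat D P)"
    "f \<in> Arr (oi_cat D P) \<Longrightarrow> Cod (oi_cat D P) f \<in> Obj (oi_cat D P)" for f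
    by (auto simp: system_immersion_def)
  show "X \<in> Obj (oi_cat D P) \<Longrightarrow> Id (oi_cat D P) X \<in> hom (oi_cat D P) X X" for X
    by (simp add: hom_def system_immersion_id)
  show "f \<in> hom (oi_cat D P) X Y \<Longrightarrow> g \<in> hom (oi_cat D P) Y Z \<Longrightarrow>
      Comp (oi_cat D P) g f \<in> hom (oi_cat D P) X Z" for f g X Y Z
    by (auto simp: hom_def system_immersion_comp)
  show "Comp (oi_cat D P) (Id (oi_cat D P) Y) f = f" if f: "f \<in> hom (oi_cat D P) X Y" for f X Y
  proof (rule arrow_eqI)
    fix c m assume cm: "(c, m) \<in> components"
    have "m f \<in> pts (c X) \<rightarrow>\<^sub>E pts (c Y)"
      using f system_immersion_component(3)[OF _ cm] by (auto simp: hom_def)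
    then show "m (Comp (oi_cat D P) (Id (oi_cat D P) Y) f) = m f"
      using f by (auto simp: hom_def component_sys_comp[OF cm] component_sys_id[OF cm]
          compose_def fun_eq_iff PiE_def extensional_def)
  qed (use f in \<open>simp_all add: hom_def\<close>)
  show "Comp (oi_cat D P) f (Id (oi_cat D P) X) = f" if f: "f \<in> hom (oi_cat D P) X Y" for f X Y
  proof (rule arrow_eqI)
    fix c m assume cm: "(c, m) \<in> components"
    have "m f \<in> pts (c X) \<rightarrow>\<^sub>E pts (c Y)"
      using f system_immersion_component(3)[OF _ cm] by (auto simp: hom_def)
    then show "m (Comp (oi_cat D P) f (Id (oi_cat D P) X)) = m f"
      using f by (auto simp: hom_def component_sys_comp[OF cm] component_sys_id[OF cm]
          compose_def fun_eq_iff PiE_def extensional_def)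
  qed (use f in \<open>simp_all add: hom_def\<close>)
  show "Comp (oi_cat D P) h (Comp (oi_cat D P) g f) = Comp (oi_cat D P) (Comp (oi_cat D P) h g) f"
    if f: "f \<in> hom (oi_cat D P) W X" and g: "g \<in> hom (oi_cat D P) X Y"
      and h: "h \<in> hom (oi_cat D P) Y Z" for f g h W X Y Z
  proof (rule arrow_eqI)
    fix c m assume cm: "(c, m) \<in> components"
    have "m f \<in> pts (c W) \<rightarrow>\<^sub>E pts (c X)"
      using f system_immersion_component(3)[OF _ cm] by (auto simp: hom_def)
    then show "m (Comp (oi_cat D P) h (Comp (oi_cat D P) g f)) =
        m (Comp (oi_cat D P) (Comp (oi_cat D P) h g) f)"
      using f g by (auto simp: hom_def component_sys_comp[OF cm] compose_def fun_eq_iff)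
  qed simp_all
qed

end

section \<open>Pullbacks as intersections\<close>

lemma component_inter_system:
  assumes "(c, m) \<in> components"
  shows "c (inter_system f g) = (dim_of (c (tgt f)), m f ` pts (c (src f)) \<inter> m g ` pts (c (src g)))"
  using assms by (auto simp: components_def inter_system_def Let_def)

lemma act_inter_system:
  "act (inter_system f g) = restrict (act (tgt f))
     (pts (before (inter_system f g)) \<times> pts (inp (inter_system f g)))"
  by (simp add: inter_system_def Let_def)

lemma component_inter_proj:
  assumes "(c, m) \<in> components"
  shows "m (inter_proj S f) = restrict (inv_into (pts (c (src f))) (m f)) (pts (c S))"
  using assms by (auto simp: components_def inter_proj_def)

lemma src_tgt_inter_proj [simp]: "src (inter_proj S f) = S" "tgt (inter_proj S f) = src f"
  by (simp_all add: inter_proj_def)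

definition inter_incl :: "sys_arrow \<Rightarrow> sys_arrow \<Rightarrow> sys_arrow"
  where "inter_incl f g = (sys_id (inter_system f g))\<lparr>tgt := tgt f\<rparr>"

lemma inter_incl_simps:
  "src (inter_incl f g) = inter_system f g" "tgt (inter_incl f g) = tgt f"
  "(c, m) \<in> components \<Longrightarrow> m (inter_incl f g) = restrict id (pts (c (inter_system f g)))"
  by (auto simp: inter_incl_def sys_id_def components_def)

context o_minimal
begin

text \<open>An input and state in the image of \<open>f\<close> come from the source, whose action provides a preimage of
  the result. Applied to two immersions, this shows that the action of the target restricts to the
  intersection.\<close>

lemma act_image:
  assumes f: "system_immersion D f"
    and b: "b \<in> m_before f ` pts (before (src f))" and i: "i \<in> m_inp f ` pts (inp (src f))"
  shows "fst (act (tgt f) (b, i)) \<in> m_after f ` pts (after (src f))"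
    and "snd (act (tgt f) (b, i)) \<in> m_outp f ` pts (outp (src f))"
proof -
  obtain x j where x: "x \<in> pts (before (src f))" "j \<in> pts (inp (src f))"
      "b = m_before f x" "i = m_inp f j" using b i by blast
  then have "act (tgt f) (b, i) =
      (m_after f (fst (act (src f) (x, j))), m_outp f (snd (act (src f) (x, j))))"
    using f respects_actD by (auto simp: system_immersion_def)
  moreover have "is_system D (src f)" using f by (simp add: system_immersion_def)
  note act_in[OF this x(1,2)]
  ultimately show "fst (act (tgt f) (b, i)) \<in> m_after f ` pts (after (src f))"
    and "snd (act (tgt f) (b, i)) \<in> m_outp f ` pts (outp (src f))" by simp_all
qed

lemma inter_component_open:
  assumes f: "system_immersion D f" and g: "system_immersion D g" and t: "tgt f = tgt g"
    and cm: "(c, m) \<in> components"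
  shows "pts (c (inter_system f g)) \<in> D (dim_of (c (tgt f)))"
    and "openin (dtop (c (tgt f))) (pts (c (inter_system f g)))"
    and "definable_set D (c (inter_system f g))"
proof -
  have "definable_set D (c (tgt f))"
    using f component_definable[OF _ cm] by (simp add: system_immersion_def)
  then have n: "1 \<le> dim_of (c (tgt f))" by (simp add: definable_set_def)
  note o = system_immersion_component(1)[OF f cm] system_immersion_component(1)[OF g cm]
  show 1: "pts (c (inter_system f g)) \<in> D (dim_of (c (tgt f)))"
    using o n t by (auto simp: component_inter_system[OF cm] definable_open_immersion_def intro!: inter)
  show "openin (dtop (c (tgt f))) (pts (c (inter_system f g)))"
    using o t by (auto simp: component_inter_system[OF cm] definable_open_immersion_def)
  show "definable_set D (c (inter_system f g))"
    using 1 n by (simp add: definable_set_def component_inter_system[OF cm])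
qed

text \<open>The only point beyond \<open>act_image\<close> is definability of the restricted action: its graph is the graph
  of the action of the target, intersected with a product of four definable sets.\<close>

lemma is_system_inter:
  assumes f: "system_immersion D f" and g: "system_immersion D g" and t: "tgt f = tgt g"
  shows "is_system D (inter_system f g)"
proof -
  let ?S = "inter_system f g" and ?T = "tgt f"
  let ?b = "dim_of (before ?T)" and ?i = "dim_of (inp ?T)"
    and ?a = "dim_of (after ?T)" and ?o = "dim_of (outp ?T)"
  have T: "is_system D ?T" using f by (simp add: system_immersion_def)
  have dims: "1 \<le> ?b" "1 \<le> ?i" "1 \<le> ?a" "1 \<le> ?o"
    using T by (auto simp: is_system_def definable_set_def)
  note pts = component_inter_system[OF component_cases(1), of f g]
    component_inter_system[OF component_cases(2), of f g]
    component_inter_system[OF component_cases(3), of f g]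
    component_inter_system[OF component_cases(4), of f g]
  note def = inter_component_open(1)[OF f g t component_cases(1)]
    inter_component_open(1)[OF f g t component_cases(2)]
    inter_component_open(1)[OF f g t component_cases(3)]
    inter_component_open(1)[OF f g t component_cases(4)]
  note rn = def[THEN subset_Rn[rotated]]
  have sub: "pts (c ?S) \<subseteq> pts (c ?T)" if "(c, m) \<in> components" for c m
    using system_immersion_component(4)[OF f that] by (auto simp: component_inter_system[OF that])
  have act: "fst (act ?T (b, i)) \<in> pts (after ?S)" "snd (act ?T (b, i)) \<in> pts (outp ?S)"
    if "b \<in> pts (before ?S)" "i \<in> pts (inp ?S)" for b i
    using act_image[OF f, of b i] act_image[OF g, of b i] that t by (simp_all add: pts)
  have maps: "act ?S \<in> pts (before ?S) \<times> pts (inp ?S) \<rightarrow>\<^sub>E pts (after ?S) \<times> pts (outp ?S)"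
    using act by (auto simp: act_inter_system mem_Times_iff)
  \<comment> \<open>\<open>?G\<close> and \<open>?H\<close> are the graphs of the action of the target and of the restricted action, and \<open>?R\<close>
      is the product of the four intersections in the same coordinates.\<close>
  let ?G = "{append_pt ?b b (append_pt ?i i (append_pt ?a a y)) | b i a y.
    b \<in> pts (before ?T) \<and> i \<in> pts (inp ?T) \<and> act ?T (b, i) = (a, y)}"
  let ?R2 = "{append_pt ?a a y | a y. a \<in> pts (after ?S) \<and> y \<in> pts (outp ?S)}"
  let ?R3 = "{append_pt ?i i w | i w. i \<in> pts (inp ?S) \<and> w \<in> ?R2}"
  let ?R = "{append_pt ?b b v | b v. b \<in> pts (before ?S) \<and> v \<in> ?R3}"
  let ?H = "{append_pt ?b b (append_pt ?i i (append_pt ?a a y)) | b i a y.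
    b \<in> pts (before ?S) \<and> i \<in> pts (inp ?S) \<and> act ?S (b, i) = (a, y)}"
  have "?R \<in> D (?b + (?i + (?a + ?o)))"
    by (rule product product[OF _ _ def(3)] product[OF _ _ def(2) def(4)] def | use dims in simp)+
  moreover have "?G \<in> D (?b + (?i + (?a + ?o)))" using T by (simp add: is_system_def)
  ultimately have "?G \<inter> ?R \<in> D (?b + (?i + (?a + ?o)))" using dims by (intro inter) auto
  moreover have "?G \<inter> ?R = ?H"
  proof (intro equalityI subsetI)
    fix w assume "w \<in> ?G \<inter> ?R"
    then obtain b i a y b' i' a' y' where w: "w = append_pt ?b b (append_pt ?i i (append_pt ?a a y))"
      and G: "b \<in> pts (before ?T)" "i \<in> pts (inp ?T)" "act ?T (b, i) = (a, y)"
      and w': "w = append_pt ?b b' (append_pt ?i i' (append_pt ?a a' y'))"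
      and R: "b' \<in> pts (before ?S)" "i' \<in> pts (inp ?S)" "a' \<in> pts (after ?S)" "y' \<in> pts (outp ?S)"
      by blast
    have "b \<in> Rn ?b" "i \<in> Rn ?i"
      using G T subset_Rn by (auto simp: is_system_def definable_set_def)
    moreover have "b' \<in> Rn ?b" "i' \<in> Rn ?i" using R rn dims by blast+
    ultimately have "b = b'" "i = i'" using w w' by (auto simp: append_pt_inject)
    then have "b \<in> pts (before ?S)" "i \<in> pts (inp ?S)" "act ?S (b, i) = (a, y)"
      using G R by (simp_all add: act_inter_system)
    then show "w \<in> ?H" using w by blast
  next
    fix w assume "w \<in> ?H"
    then obtain b i a y where w: "w = append_pt ?b b (append_pt ?i i (append_pt ?a a y))"
      and S: "b \<in> pts (before ?S)" "i \<in> pts (inp ?S)" "act ?S (b, i) = (a, y)" by blast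
    then have T: "act ?T (b, i) = (a, y)" by (simp add: act_inter_system)
    then have "a \<in> pts (after ?S)" "y \<in> pts (outp ?S)" using act[OF S(1,2)] by simp_all
    then have "w \<in> ?R" using w S by blast
    moreover have "w \<in> ?G" using w S T sub[OF component_cases(1)] sub[OF component_cases(3)] by blast
    ultimately show "w \<in> ?G \<inter> ?R" by blast
  qed
  ultimately have "?H \<in> D (?b + (?i + (?a + ?o)))" by simp
  then have "{append_pt (dim_of (before ?S)) b (append_pt (dim_of (inp ?S)) i (append_pt (dim_of (after ?S)) a y))
      | b i a y. b \<in> pts (before ?S) \<and> i \<in> pts (inp ?S) \<and> act ?S (b, i) = (a, y)}
      \<in> D (dim_of (before ?S) + (dim_of (inp ?S) + (dim_of (after ?S) + dim_of (outp ?S))))"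
    by (simp add: pts)
  then show ?thesis
    using maps inter_component_open(3)[OF f g t] component_cases unfolding is_system_def by blast
qed

lemma system_immersion_inter_incl:
  assumes f: "system_immersion D f" and g: "system_immersion D g" and t: "tgt f = tgt g"
  shows "system_immersion D (inter_incl f g)"
proof (rule system_immersionI)
  have T: "is_system D (tgt f)" using f by (simp add: system_immersion_def)
  show S: "is_system D (src (inter_incl f g))"
    by (simp add: inter_incl_simps is_system_inter[OF assms])
  show "is_system D (tgt (inter_incl f g))" using T by (simp add: inter_incl_simps)
  show "definable_open_immersion D (c (src (inter_incl f g))) (c (tgt (inter_incl f g))) (m (inter_incl f g))"
    if cm: "(c, m) \<in> components" for c m
  proof -
    have "c (inter_system f g) = (dim_of (c (tgt f)), pts (c (inter_system f g)))"
      by (simp add: component_inter_system[OF cm])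
    then show ?thesis
      using open_immersion_inclusion[OF component_definable[OF T cm]
          inter_component_open(1,2)[OF assms cm]]
      unfolding inter_incl_simps(1,2) inter_incl_simps(3)[OF cm] by simp
  qed
  show "respects_act (inter_incl f g)"
  proof (rule respects_actI)
    fix b i assume bi: "b \<in> pts (before (src (inter_incl f g)))" "i \<in> pts (inp (src (inter_incl f g)))"
    have "act (inter_system f g) (b, i) = act (tgt f) (b, i)"
      using bi by (simp add: act_inter_system inter_incl_simps)
    then show "act (tgt (inter_incl f g)) (m_before (inter_incl f g) b, m_inp (inter_incl f g) i) =
      (m_after (inter_incl f g) (fst (act (src (inter_incl f g)) (b, i))),
       m_outp (inter_incl f g) (snd (act (src (inter_incl f g)) (b, i))))"
      using act_in[OF S bi] bi
      by (simp add: inter_incl_simps(1,2) inter_incl_simps(3)[OF component_cases(1)]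
          inter_incl_simps(3)[OF component_cases(2)] inter_incl_simps(3)[OF component_cases(3)]
          inter_incl_simps(3)[OF component_cases(4)])
  qed
qed

text \<open>The comparison maps \<open>inter_proj\<close> are given by inverses of the components of \<open>f\<close>; they are
  recognized here as the lift along \<open>f\<close> of an inclusion \<open>\<iota>\<close>.\<close>

lemma inter_proj_lift:
  assumes \<iota>: "system_immersion D \<iota>" and f: "system_immersion D f" and t: "tgt f = tgt \<iota>"
    and incl: "\<And>c m. (c, m) \<in> components \<Longrightarrow> m \<iota> = restrict id (pts (c (src \<iota>)))"
      "\<And>c m. (c, m) \<in> components \<Longrightarrow> pts (c (src \<iota>)) \<subseteq> m f ` pts (c (src f))"
  shows "system_immersion D (inter_proj (src \<iota>) f)" "sys_comp f (inter_proj (src \<iota>) f) = \<iota>"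
proof -
  have 1: "m (inter_proj (src \<iota>) f) \<in> pts (c (src \<iota>)) \<rightarrow>\<^sub>E pts (c (src f))"
    if "(c, m) \<in> components" for c m
    unfolding component_inter_proj[OF that] restrict_PiE_iff
    using incl(2)[OF that] by (blast intro: inv_into_into)
  have 2: "m f (m (inter_proj (src \<iota>) f) x) = m \<iota> x"
    if "(c, m) \<in> components" "x \<in> pts (c (src \<iota>))" for c m x
  proof -
    have "x \<in> m f ` pts (c (src f))" "m \<iota> x = x" 
      using incl(1)[OF that(1)] incl(2)[OF that(1)] that(2) by auto
    then show ?thesis using that(2) by (simp add: component_inter_proj[OF that(1)] f_inv_into_f)
  qed
  show "system_immersion D (inter_proj (src \<iota>) f)"
    by (rule system_immersion_lift(1)[OF f \<iota> t]; (rule src_tgt_inter_proj | erule 1 | erule (1) 2))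
  show "sys_comp f (inter_proj (src \<iota>) f) = \<iota>"
    by (rule system_immersion_lift(2)[OF f \<iota> t]; (rule src_tgt_inter_proj | erule 1 | erule (1) 2))
qed

text \<open>The universal property of an open immersion: every open immersion into the same system with a smaller image
  factors through it.\<close>

lemma lift_exists:
  assumes f: "system_immersion D f" and h: "system_immersion D h" and t: "tgt f = tgt h"
    and sub: "\<And>c m. (c, m) \<in> components \<Longrightarrow> m h ` pts (c (src h)) \<subseteq> m f ` pts (c (src f))"
  obtains u where "system_immersion D u" "src u = src h" "tgt u = src f" "sys_comp f u = h"
proof -
  let ?l = "\<lambda>c m. restrict (\<lambda>x. inv_into (pts (c (src f))) (m f) (m h x)) (pts (c (src h)))"
  define u where "u = \<lparr>src = src h, tgt = src f, m_before = ?l before m_before,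
    m_after = ?l after m_after, m_inp = ?l inp m_inp, m_outp = ?l outp m_outp\<rparr>"
  have l: "m u = ?l c m" if "(c, m) \<in> components" for c m
    using that by (auto simp: components_def u_def)
  have 1: "m u \<in> pts (c (src h)) \<rightarrow>\<^sub>E pts (c (src f))" if "(c, m) \<in> components" for c m
    unfolding l[OF that] restrict_PiE_iff using sub[OF that] by (blast intro: inv_into_into)
  have 2: "m f (m u x) = m h x" if "(c, m) \<in> components" "x \<in> pts (c (src h))" for c m x
    using subsetD[OF sub[OF that(1)] imageI[OF that(2)]] that(2)
    by (simp add: l[OF that(1)] f_inv_into_f)
  have st: "src u = src h" "tgt u = src f" by (simp_all add: u_def)
  have "system_immersion D u"
    by (rule system_immersion_lift(1)[OF f h t st]; (erule 1 | erule (1) 2))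
  moreover have "sys_comp f u = h"
    by (rule system_immersion_lift(2)[OF f h t st]; (erule 1 | erule (1) 2))
  ultimately show ?thesis using st that by blast
qed

lemma image_sys_comp:
  assumes "(c, m) \<in> components" "system_immersion D h" "tgt h = src f"
  shows "m (sys_comp f h) ` pts (c (src h)) \<subseteq> m f ` pts (c (src f))"
  using system_immersion_component(4)[OF assms(2,1)] assms(3)
  by (auto simp: component_sys_comp[OF assms(1)] compose_def)

text \<open>The two projections are lifts of the inclusion of the intersection. A competing square \<open>(h, k)\<close>
  has a diagonal \<open>f \<circ> h = g \<circ> k\<close> with image in the intersection; the mediating arrow \<open>u\<close> is the lift of
  this diagonal along the inclusion. The equations for \<open>u\<close> follow by cancelling the monomorphisms
  \<open>f\<close> and \<open>g\<close>, and uniqueness by cancelling the projection.\<close>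

lemma inter_pullback:
  assumes f: "f \<in> Arr (oi_cat D P)" and g: "g \<in> Arr (oi_cat D P)" and t: "tgt f = tgt g"
    and P: "P (inter_system f g)"
  shows "is_inter_pullback (oi_cat D P) f g"
proof -
  let ?C = "oi_cat D P" and ?S = "inter_system f g"
  let ?p = "inter_proj ?S f" and ?q = "inter_proj ?S g" and ?\<iota> = "inter_incl f g"
  have F: "system_immersion D f" "P (src f)" and G: "system_immersion D g" "P (src g)"
    using f g by auto
  interpret category ?C by (rule category_oi)
  have \<iota>: "system_immersion D ?\<iota>" by (rule system_immersion_inter_incl[OF F(1) G(1) t])
  have incl: "m ?\<iota> = restrict id (pts (c (src ?\<iota>)))" "pts (c (src ?\<iota>)) \<subseteq> m f ` pts (c (src f))"
      "pts (c (src ?\<iota>)) \<subseteq> m g ` pts (c (src g))" if cm: "(c, m) \<in> components" for c m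
    unfolding inter_incl_simps(1) inter_incl_simps(3)[OF cm]
    by (auto simp: component_inter_system[OF cm])
  note t\<iota> = inter_incl_simps(2)[of f g]
  have p: "system_immersion D ?p" "sys_comp f ?p = ?\<iota>"
    by (rule inter_proj_lift[OF \<iota> F(1), unfolded inter_incl_simps(1)];
        (simp add: t\<iota>; fail | erule incl[unfolded inter_incl_simps(1)]))+
  have q: "system_immersion D ?q" "sys_comp g ?q = ?\<iota>"
    by (rule inter_proj_lift[OF \<iota> G(1), unfolded inter_incl_simps(1)];
        (simp add: t\<iota> t; fail | erule incl[unfolded inter_incl_simps(1)]))+
  have "commuting_square ?C f g ?p ?q"
    using f g t p q P by (simp add: commuting_square_def)
  moreover have "\<exists>!u. u \<in> hom ?C (Dom ?C h) (Dom ?C ?p) \<and> Comp ?C ?p u = h \<and> Comp ?C ?q u = k"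
    if "commuting_square ?C f g h k" for h k
  proof -
    have h: "system_immersion D h" "tgt h = src f" "P (src h)"
      and k: "system_immersion D k" "tgt k = src g" "src k = src h"
      and e: "sys_comp f h = sys_comp g k"
      using that by (auto simp: commuting_square_def)
    let ?t = "sys_comp f h"
    have t': "system_immersion D ?t" by (rule system_immersion_comp) (use h F in simp_all)
    have sub: "m ?t ` pts (c (src ?t)) \<subseteq> m ?\<iota> ` pts (c (src ?\<iota>))" if cm: "(c, m) \<in> components" for c m
      using image_sys_comp[OF cm h(1,2)] image_sys_comp[OF cm k(1,2)] e k(3)
      by (simp add: inter_incl_simps(1) inter_incl_simps(3)[OF cm] component_inter_system[OF cm])
    have "tgt ?\<iota> = tgt ?t" by (simp add: inter_incl_simps(2))
    then obtain u where "system_immersion D u" "src u = src ?t" "tgt u = src ?\<iota>" "sys_comp ?\<iota> u = ?t"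
      using lift_exists[OF \<iota> t'] sub by blast
    then have u: "system_immersion D u" "src u = src h" "tgt u = ?S" "sys_comp ?\<iota> u = ?t"
      by (simp_all add: inter_incl_simps(1))
    have hom: "u \<in> hom ?C (src h) ?S" "?p \<in> hom ?C ?S (src f)" "?q \<in> hom ?C ?S (src g)"
      "f \<in> hom ?C (src f) (tgt f)" "g \<in> hom ?C (src g) (tgt f)"
      using u p q F G P h t f g by (auto simp: hom_def)
    have pu: "sys_comp ?p u = h"
    proof (rule system_immersion_mono[OF F(1) _ h(1)])
      show "system_immersion D (sys_comp ?p u)" by (rule system_immersion_comp) (use u p in simp_all)
      show "sys_comp f (sys_comp ?p u) = sys_comp f h"
        using assoc[OF hom(1) hom(2) hom(4)] p(2) u(4) by simp
    qed (use u h in simp_all)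
    have qu: "sys_comp ?q u = k"
    proof (rule system_immersion_mono[OF G(1) _ k(1)])
      show "system_immersion D (sys_comp ?q u)" by (rule system_immersion_comp) (use u q in simp_all)
      show "sys_comp g (sys_comp ?q u) = sys_comp g k"
        using assoc[OF hom(1) hom(3) hom(5)] q(2) u(4) e by simp
    qed (use u k in simp_all)
    have uniq: "v = u" if v: "v \<in> hom ?C (src h) ?S" "sys_comp ?p v = h" for v
      using system_immersion_mono[OF p(1), of v u] v u pu by (auto simp: hom_def)
    show ?thesis
    proof (rule ex1I[of _ u])
      show "u \<in> hom ?C (Dom ?C h) (Dom ?C ?p) \<and> Comp ?C ?p u = h \<and> Comp ?C ?q u = k"
        using hom(1) pu qu by simp
      show "v = u"
        if "v \<in> hom ?C (Dom ?C h) (Dom ?C ?p) \<and> Comp ?C ?p v = h \<and> Comp ?C ?q v = k" for v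
        using uniq[of v] that by simp
    qed
  qed
  ultimately show ?thesis by (simp add: is_inter_pullback_def is_pullback_def)
qed

text \<open>The diagonal of a commuting square maps its corner into the intersection, so a nonempty component
  of the corner forces the same component of the intersection to be nonempty.\<close>

lemma commuting_square_meets:
  assumes cs: "commuting_square (oi_cat D P) f g h k" and cm: "(c, m) \<in> components"
    and "pts (c (src h)) \<noteq> {}"
  shows "pts (c (inter_system f g)) \<noteq> {}"
proof -
  have h: "system_immersion D h" "tgt h = src f"
    and k: "system_immersion D k" "tgt k = src g" "src k = src h"
    and e: "sys_comp f h = sys_comp g k"
    using cs by (auto simp: commuting_square_def)
  have "m (sys_comp f h) ` pts (c (src h)) \<subseteq> pts (c (inter_system f g))"
    using image_sys_comp[OF cm h] image_sys_comp[OF cm k(1,2)] e k(3)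
    by (simp add: component_inter_system[OF cm])
  then show ?thesis using assms(3) by blast
qed

text \<open>The projection from the intersection to the source of \<open>g\<close> hits every point that \<open>g\<close> maps into the
  image of \<open>f\<close>. By the universal property of \<open>(p, q)\<close> this projection factors through \<open>q\<close>, so the
  image of \<open>q\<close> contains all these points as well.\<close>

lemma pullback_image:
  assumes pb: "is_pullback (oi_cat D P) f g p q" and P: "P (inter_system f g)"
    and cm: "(c, m) \<in> components" and y: "y \<in> pts (c (src g))" "m g y \<in> m f ` pts (c (src f))"
  shows "y \<in> m q ` pts (c (src q))"
proof -
  let ?C = "oi_cat D P" and ?S = "inter_system f g"
  let ?q = "inter_proj ?S g"
  have cs: "commuting_square ?C f g p q" using pb by (simp add: is_pullback_def)
  then have fg: "f \<in> Arr ?C" "g \<in> Arr ?C" "tgt f = tgt g" and pq: "src p = src q"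
    by (auto simp: commuting_square_def)
  have "commuting_square ?C f g (inter_proj ?S f) ?q"
    using inter_pullback[OF fg P] by (simp add: is_inter_pullback_def is_pullback_def)
  then obtain u where "u \<in> hom ?C (Dom ?C (inter_proj ?S f)) (Dom ?C p)" "Comp ?C q u = ?q"
    using pb unfolding is_pullback_def by blast
  then have u: "u \<in> hom ?C ?S (src p)" "sys_comp q u = ?q" by simp_all
  have "m g y \<in> pts (c ?S)" using y by (simp add: component_inter_system[OF cm])
  moreover have "inj_on (m g) (pts (c (src g)))"
    using system_immersion_component(2)[OF _ cm, of D g] fg by simp
  ultimately have "m ?q (m g y) = y"
    using y by (simp add: component_inter_proj[OF cm] inv_into_f_f)
  moreover have "m ?q ` pts (c ?S) \<subseteq> m q ` pts (c (src q))"
    using image_sys_comp[OF cm, of u q] u pq by (auto simp: hom_def)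
  ultimately show ?thesis using \<open>m g y \<in> pts (c ?S)\<close> by force
qed

end

section \<open>The pretopology\<close>

text \<open>The two pairs of components whose products a covering has to exhaust: the domain and the codomain
  of the action.\<close>

definition product_components ::
    "((system \<Rightarrow> dset) \<times> (sys_arrow \<Rightarrow> pt \<Rightarrow> pt) \<times> (system \<Rightarrow> dset) \<times> (sys_arrow \<Rightarrow> pt \<Rightarrow> pt)) set"
  where "product_components = {(before, m_before, inp, m_inp), (after, m_after, outp, m_outp)}"

lemma product_components:
  "(c, m, c', m') \<in> product_components \<Longrightarrow> (c, m) \<in> components \<and> (c', m') \<in> components"
  by (auto simp: product_components_def components_def)

context o_minimal
begin

text \<open>Joint surjectivity stated pointwise; the converse inclusions hold because arrows into \<open>S\<close> have
  their images in \<open>S\<close>.\<close>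

lemma Cov_iff:
  "R \<in> Cov (oi_cat D P) S \<longleftrightarrow> finite R \<and> R \<subseteq> {f \<in> Arr (oi_cat D P). tgt f = S} \<and>
    (\<forall>(c, m, c', m') \<in> product_components. \<forall>x \<in> pts (c S). \<forall>y \<in> pts (c' S).
      \<exists>f\<in>R. x \<in> m f ` pts (c (src f)) \<and> y \<in> m' f ` pts (c' (src f)))"
proof -
  have cover: "(\<Union>f\<in>R. map_prod (m f) (m' f) ` (pts (c (src f)) \<times> pts (c' (src f)))) = pts (c S) \<times> pts (c' S)
    \<longleftrightarrow> (\<forall>x \<in> pts (c S). \<forall>y \<in> pts (c' S).
      \<exists>f\<in>R. x \<in> m f ` pts (c (src f)) \<and> y \<in> m' f ` pts (c' (src f)))" (is "?L = ?U \<longleftrightarrow> ?A")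
    if R: "R \<subseteq> {f \<in> Arr (oi_cat D P). tgt f = S}" and "(c, m, c', m') \<in> product_components" for c m c' m'
  proof -
    note cm = product_components[OF that(2), THEN conjunct1] product_components[OF that(2), THEN conjunct2]
    have "?L \<subseteq> ?U"
      using R system_immersion_component(4)[OF _ cm(1)] system_immersion_component(4)[OF _ cm(2)]
      by fastforce
    moreover have "?U \<subseteq> ?L \<longleftrightarrow> ?A" by (fastforce simp: subset_iff)
    ultimately show ?thesis by blast
  qed
  show ?thesis
  proof (cases "R \<subseteq> {f \<in> Arr (oi_cat D P). tgt f = S}")
    case True
    have pc: "(before, m_before, inp, m_inp) \<in> product_components"
      "(after, m_after, outp, m_outp) \<in> product_components" by (simp_all add: product_components_def)
    show ?thesis
      unfolding Cov_def mem_Collect_eq oi_cat_simps(4) cover[OF True pc(1)] cover[OF True pc(2)]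
        product_components_def by simp
  next
    case False
    then show ?thesis unfolding Cov_def mem_Collect_eq oi_cat_simps(4) by blast
  qed
qed

lemma CovI:
  assumes "finite R" "R \<subseteq> {f \<in> Arr (oi_cat D P). tgt f = S}"
    and "\<And>c m c' m' x y. (c, m, c', m') \<in> product_components \<Longrightarrow> x \<in> pts (c S) \<Longrightarrow> y \<in> pts (c' S) \<Longrightarrow>
      \<exists>f\<in>R. x \<in> m f ` pts (c (src f)) \<and> y \<in> m' f ` pts (c' (src f))"
  shows "R \<in> Cov (oi_cat D P) S"
  unfolding Cov_iff
proof (intro conjI ballI)
  fix z assume "z \<in> product_components"
  then show "case z of (c, m, c', m') \<Rightarrow> \<forall>x \<in> pts (c S). \<forall>y \<in> pts (c' S).
      \<exists>f\<in>R. x \<in> m f ` pts (c (src f)) \<and> y \<in> m' f ` pts (c' (src f))"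
    by (cases z) (simp add: assms(3))
qed (rule assms)+

lemma CovD:
  assumes "R \<in> Cov (oi_cat D P) S" "(c, m, c', m') \<in> product_components"
    "x \<in> pts (c S)" "y \<in> pts (c' S)"
  obtains f x' y' where "f \<in> R" "x = m f x'" "y = m' f y'" "x' \<in> pts (c (src f))" "y' \<in> pts (c' (src f))"
  using assms unfolding Cov_iff by blast

lemma cov_families_oi: "cov_families (oi_cat D P) (Cov (oi_cat D P))"
  by (auto simp: cov_families_def Cov_def)

lemma cov_iso_oi: "cov_iso (oi_cat D P) (Cov (oi_cat D P))"
  unfolding cov_iso_def
proof (intro allI impI)
  fix f assume "is_iso (oi_cat D P) f"
  then obtain g where f: "f \<in> Arr (oi_cat D P)" and g: "g \<in> Arr (oi_cat D P)" "src g = tgt f" "tgt g = src f"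
    and fg: "sys_comp f g = sys_id (tgt f)" by (auto simp: is_iso_def hom_def)
  have surj: "x \<in> m f ` pts (c (src f))" if cm: "(c, m) \<in> components" and x: "x \<in> pts (c (tgt f))" for c m x
  proof -
    have "m (sys_comp f g) x = x" using x by (simp add: fg component_sys_id[OF cm])
    then have "m f (m g x) = x" using x g by (simp add: component_sys_comp[OF cm] compose_def)
    moreover have "m g x \<in> pts (c (src f))" using system_immersion_component(4)[OF _ cm, of D g] x g by simp
    ultimately show ?thesis by force
  qed
  show "{f} \<in> Cov (oi_cat D P) (Cod (oi_cat D P) f)"
    unfolding Cov_iff using f by (auto dest!: product_components intro!: surj)
qed

text \<open>A point of the source of \<open>g\<close> is mapped by \<open>g\<close> into the image of some member \<open>f\<close> of the covering, and
  then lies in the image of the pullback of \<open>f\<close>. The hypothesis turns the given pullback squares into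
  the knowledge that the intersections belong to the category.\<close>

lemma cov_stable_oi:
  assumes P: "\<And>f g h k. commuting_square (oi_cat D P) f g h k \<Longrightarrow> P (inter_system f g)"
  shows "cov_stable (oi_cat D P) (Cov (oi_cat D P))"
  unfolding cov_stable_def
proof (intro ballI allI impI)
  let ?C = "oi_cat D P"
  fix g R p q
  assume g: "g \<in> Arr ?C" and R: "R \<in> Cov ?C (Cod ?C g)"
    and pb: "\<forall>f\<in>R. is_pullback ?C f g (p f) (q f)"
  have cs: "commuting_square ?C f g (p f) (q f)" if "f \<in> R" for f
    using pb that by (simp add: is_pullback_def)
  then have q: "q f \<in> Arr ?C \<and> tgt (q f) = src g" if "f \<in> R" for f
    using that by (auto simp: commuting_square_def)
  have cov: "\<exists>f\<in>q ` R. x \<in> m f ` pts (c (src f)) \<and> y \<in> m' f ` pts (c' (src f))"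
    if pc: "(c, m, c', m') \<in> product_components" and x: "x \<in> pts (c (src g))" and y: "y \<in> pts (c' (src g))"
    for c m c' m' x y
  proof -
    note cm = product_components[OF pc, THEN conjunct1] product_components[OF pc, THEN conjunct2]
    have "m g x \<in> pts (c (tgt g))" "m' g y \<in> pts (c' (tgt g))"
      using system_immersion_component(4)[OF _ cm(1)] system_immersion_component(4)[OF _ cm(2)] g x y
      by auto
    then obtain f x' y' where f: "f \<in> R" "m g x = m f x'" "m' g y = m' f y'"
      "x' \<in> pts (c (src f))" "y' \<in> pts (c' (src f))"
      using CovD[OF R pc] by (metis oi_cat_simps(4))
    have pbf: "is_pullback ?C f g (p f) (q f)" using pb f(1) by blast
    have "x \<in> m (q f) ` pts (c (src (q f)))" "y \<in> m' (q f) ` pts (c' (src (q f)))"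
      using pullback_image[OF pbf P[OF cs[OF f(1)]] cm(1) x] f(2,4)
        pullback_image[OF pbf P[OF cs[OF f(1)]] cm(2) y] f(3,5) by blast+
    then show ?thesis using f by blast
  qed
  have "finite (q ` R)" "q ` R \<subseteq> {f \<in> Arr ?C. tgt f = src g}"
    using q R by (auto simp: Cov_def)
  then show "q ` R \<in> Cov ?C (Dom ?C g)"
    unfolding oi_cat_simps(3) by (rule CovI) (rule cov)
qed

lemma cov_transitive_oi: "cov_transitive (oi_cat D P) (Cov (oi_cat D P))"
  unfolding cov_transitive_def
proof (intro ballI allI impI)
  let ?C = "oi_cat D P"
  fix X R T assume R: "R \<in> Cov ?C X" and T: "\<forall>f\<in>R. T f \<in> Cov ?C (Dom ?C f)"
  let ?Q = "{sys_comp f h | f h. f \<in> R \<and> h \<in> T f}"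
  have arr: "f \<in> Arr ?C \<and> tgt f = X" if "f \<in> R" for f using R that by (auto simp: Cov_def)
  have arr': "h \<in> Arr ?C \<and> tgt h = src f" if "f \<in> R" "h \<in> T f" for f h
    using T that by (fastforce simp: Cov_def)
  have "?Q = (\<Union>f\<in>R. sys_comp f ` T f)" by blast
  moreover have "finite R" "\<And>f. f \<in> R \<Longrightarrow> finite (T f)" using R T by (auto simp: Cov_def)
  ultimately have fin: "finite ?Q" by simp
  have sub: "?Q \<subseteq> {f \<in> Arr ?C. tgt f = X}"
    using arr arr' by (fastforce intro!: system_immersion_comp)
  have cov: "\<exists>f\<in>?Q. x \<in> m f ` pts (c (src f)) \<and> y \<in> m' f ` pts (c' (src f))"
    if pc: "(c, m, c', m') \<in> product_components" and x: "x \<in> pts (c X)" and y: "y \<in> pts (c' X)"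
    for c m c' m' x y
  proof -
    note cm = product_components[OF pc, THEN conjunct1] product_components[OF pc, THEN conjunct2]
    obtain f x' y' where f: "f \<in> R" "x = m f x'" "y = m' f y'"
      "x' \<in> pts (c (src f))" "y' \<in> pts (c' (src f))" using CovD[OF R pc x y] .
    moreover have "T f \<in> Cov ?C (src f)" using T f(1) by simp
    then obtain h x'' y'' where h: "h \<in> T f" "x' = m h x''" "y' = m' h y''"
      "x'' \<in> pts (c (src h))" "y'' \<in> pts (c' (src h))" using CovD[OF _ pc f(4,5)] by blast
    ultimately have "x = m (sys_comp f h) x''" "y = m' (sys_comp f h) y''"
      by (simp_all add: component_sys_comp[OF cm(1)] component_sys_comp[OF cm(2)] compose_def)
    then have "x \<in> m (sys_comp f h) ` pts (c (src (sys_comp f h)))"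
      "y \<in> m' (sys_comp f h) ` pts (c' (src (sys_comp f h)))" using h by simp_all
    then show ?thesis using f(1) h(1) by blast
  qed
  show "{Comp ?C f h | f h. f \<in> R \<and> h \<in> T f} \<in> Cov ?C X"
    unfolding oi_cat_simps(6) by (rule CovI[OF fin sub]) (rule cov)
qed

end

section \<open>The site of systems\<close>

theorem proposition2p7:
  fixes D :: "nat \<Rightarrow> (nat \<Rightarrow> real) set set"
  assumes "o_minimal D"
  shows
    "category (Sys_oi D)
     \<and> (\<forall>f\<in>Arr (Sys_oi D). \<forall>g\<in>Arr (Sys_oi D). tgt f = tgt g \<longrightarrow>
          ((\<exists>h k. commuting_square (Sys_oi D) f g h k) \<longleftrightarrow> nonempty_io (inter_system f g))
          \<and> (nonempty_io (inter_system f g) \<longrightarrow> is_inter_pullback (Sys_oi D) f g))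
     \<and> cov_families (Sys_oi D) (Cov (Sys_oi D))
     \<and> cov_iso (Sys_oi D) (Cov (Sys_oi D))
     \<and> cov_stable (Sys_oi D) (Cov (Sys_oi D))
     \<and> cov_transitive (Sys_oi D) (Cov (Sys_oi D))
     \<and> has_pullbacks (Sys_oi_ext D)
     \<and> (\<forall>f\<in>Arr (Sys_oi_ext D). \<forall>g\<in>Arr (Sys_oi_ext D). tgt f = tgt g \<longrightarrow>
          is_inter_pullback (Sys_oi_ext D) f g)
     \<and> grothendieck_pretopology (Sys_oi_ext D) (Cov (Sys_oi_ext D))
     \<and> site (Sys_oi_ext D) (Cov (Sys_oi_ext D))"
proof -
  interpret o_minimal D by (rule assms)
  let ?C = "Sys_oi D" and ?E = "Sys_oi_ext D"
  have C: "?C = oi_cat D nonempty_io" by (simp add: Sys_oi_def Sys_def)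
  have E: "?E = oi_cat D (\<lambda>S. True)" by (simp add: Sys_oi_ext_def)
  have meets: "nonempty_io (inter_system f g)" if cs: "commuting_square ?C f g h k" for f g h k
  proof -
    have "nonempty_io (src h)" using cs by (simp add: commuting_square_def C)
    then show ?thesis
      using commuting_square_meets[OF cs[unfolded C]] component_cases unfolding nonempty_io_def by metis
  qed
  have pb: "is_inter_pullback ?C f g" "\<exists>h k. commuting_square ?C f g h k"
    if "f \<in> Arr ?C" "g \<in> Arr ?C" "tgt f = tgt g" "nonempty_io (inter_system f g)" for f g
  proof -
    show "is_inter_pullback ?C f g" using inter_pullback that unfolding C by blast
    then show "\<exists>h k. commuting_square ?C f g h k"
      by (auto simp: is_inter_pullback_def is_pullback_def)
  qed
  have pb_ext: "is_inter_pullback ?E f g" if "f \<in> Arr ?E" "g \<in> Arr ?E" "tgt f = tgt g" for f g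
    using inter_pullback that unfolding E by blast
  then have has: "has_pullbacks ?E"
    unfolding has_pullbacks_def is_inter_pullback_def by (metis E oi_cat_simps(4))
  then have "cov_base_change ?E (Cov ?E)"
    unfolding has_pullbacks_def cov_base_change_def by (auto simp: Cov_def)
  then have top: "grothendieck_pretopology ?E (Cov ?E)"
    using cov_families_oi cov_iso_oi cov_stable_oi[of "\<lambda>S. True"] cov_transitive_oi
    by (simp add: grothendieck_pretopology_def E)
  have site: "site ?E (Cov ?E)" using top category_oi by (simp add: site_def E)
  have stable: "cov_stable ?C (Cov ?C)" unfolding C by (rule cov_stable_oi) (rule meets[unfolded C])
  show ?thesis
    using category_oi[of nonempty_io] cov_families_oi[of nonempty_io] cov_iso_oi[of nonempty_io]
      cov_transitive_oi[of nonempty_io] stable meets pb pb_ext has top site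
    by (simp only: C[symmetric]) blast
qed

end
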